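(* Let $k\ge2$ be a fixed integer, $\lambda=k-1$, and let $n$ range over multiples of $k$. Let $b=b(n)>0$ satisfy $b^{-1}\log^{-2}n=o(1)$ as $n\to\infty$, and let $\widetilde\xi=\left(\mathbb{E}_n^{\{0,k\}}(\mathbf{B})\right)^b$. Let $f_1,f_2,\dots$ be independent uniformly random $\{0,k\}$-mappings on $n$ nodes, and let $\widetilde{\mathbf{N}}=\min\{t:\mathbf{B}(f_t)\ge\widetilde\xi\}$. Then there exist positive constants $c_1,c_2$ such that, for sufficiently large $n$, $$\mathbb{E}(\widetilde{\mathbf{N}})>\exp\left(c_1\frac{(n/\lambda)^{1/3}}{\log^3(n/\lambda)}\right),$$ and in addition $$\mathbb{P}\left(\widetilde{\mathbf{N}}\le\exp\left(c_2\frac{(n/\lambda)^{1/3}}{\log^3(n/\lambda)}\right)\right)\le\exp\left(-c_2\frac{(n/\lambda)^{1/3}}{\log^3(n/\lambda)}\right).$$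
   Context: A $\{0,k\}$-mapping on $n$ nodes is a function $f:\{1,\dots,n\}\to\{1,\dots,n\}$ with $|f^{-1}(y)|\in\{0,k\}$ for every $y$. $\mathbf{B}(f)$ is the product of the lengths of all cycles of $f$, counted with multiplicity. $\mathbb{E}_n^{\{0,k\}}$ denotes expectation under the uniform distribution on $\{0,k\}$-mappings on $\{1,\dots,n\}$. *)

theory Defs
  imports "HOL-Probability.Probability" "HOL-Combinatorics.Orbits"
begin

text \<open>Mappings of \<open>{1..n}\<close> into itself are taken extensional, so that each of them is
  represented by exactly one HOL function and the set of mappings is finite.\<close>

definition zero_k_mappings :: "nat \<Rightarrow> nat \<Rightarrow> (nat \<Rightarrow> nat) set" where
  "zero_k_mappings k n =
     {f \<in> {1..n} \<rightarrow>\<^sub>E {1..n}. \<forall>y\<in>{1..n}. card {x \<in> {1..n}. f x = y} \<in> {0, k}}"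

text \<open>The restriction to subsets of \<open>{1..n}\<close> matters: the value \<open>undefined\<close> may be an
  additional fixed point of an extensional function.\<close>

definition mapping_cycles :: "nat \<Rightarrow> (nat \<Rightarrow> nat) \<Rightarrow> nat set set" where
  "mapping_cycles n f = {C. C \<subseteq> {1..n} \<and> cyclic_on f C}"

text \<open>The product ranges over the cycles, not over the set of their lengths; this is
  the counting with multiplicity.\<close>

definition cycle_product :: "nat \<Rightarrow> (nat \<Rightarrow> nat) \<Rightarrow> nat" where
  "cycle_product n f = (\<Prod>C\<in>mapping_cycles n f. card C)"

definition uniform_zero_k_mapping :: "nat \<Rightarrow> nat \<Rightarrow> (nat \<Rightarrow> nat) pmf" where
  "uniform_zero_k_mapping k n = pmf_of_set (zero_k_mappings k n)"

definition expected_cycle_product :: "nat \<Rightarrow> nat \<Rightarrow> real" where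
  "expected_cycle_product k n =
     measure_pmf.expectation (uniform_zero_k_mapping k n) (\<lambda>f. real (cycle_product n f))"

definition iid_uniform_mappings ::
  "nat \<Rightarrow> nat \<Rightarrow> 'a measure \<Rightarrow> (nat \<Rightarrow> 'a \<Rightarrow> (nat \<Rightarrow> nat)) \<Rightarrow> bool" where
  "iid_uniform_mappings k n M F \<longleftrightarrow>
     prob_space M \<and>
     prob_space.indep_vars M (\<lambda>_. count_space UNIV) F {1..} \<and>
     (\<forall>t\<ge>1. distr M (count_space UNIV) (F t) = measure_pmf (uniform_zero_k_mapping k n))"

text \<open>The infimum of the empty set in \<^typ>\<open>enat\<close> is \<open>\<infinity>\<close>: the waiting time is infinite
  if the threshold \<open>x\<close> is never reached.\<close>

definition waiting_time :: "nat \<Rightarrow> real \<Rightarrow> (nat \<Rightarrow> 'a \<Rightarrow> (nat \<Rightarrow> nat)) \<Rightarrow> 'a \<Rightarrow> enat" where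
  "waiting_time n x F \<omega> = Inf (enat ` {t. t \<ge> 1 \<and> real (cycle_product n (F t \<omega>)) \<ge> x})"

definition multiples_at_top :: "nat \<Rightarrow> nat filter" where
  "multiples_at_top k = inf at_top (principal {n. k dvd n})"

end

theory Submission
  imports Defs "HOL-Real_Asymp.Real_Asymp"
begin

text \<open>Both \<open>B(f) = \<Prod> ((|C| - 1) + 1)\<close> and \<open>2^N = \<Prod> (1 + 1)\<close>, with \<open>N\<close> the number of cycles \<open>C\<close>
  of \<open>f\<close>, expand into sums over the sets \<open>A\<close> with \<open>f ` A = A\<close>, because these are the unions of
  cycles. The probability that \<open>f\<close> restricts to a given permutation of a given set of size \<open>z\<close> is
  \<open>\<Prod>t<z. (n - kt) / (n - t)\<^sup>2\<close>. Hence the expectation of \<open>2^N\<close> is at most \<open>n + 1\<close>, and that of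
  \<open>B\<close> is at least \<open>p\<^sub>z \<Prod>t<z. (n - kt) / (n - t)\<close> for every \<open>z\<close>, where \<open>p\<^sub>z\<close> is the coefficient of
  \<open>x\<^sup>z\<close> in \<open>(1 - x) exp (x / (1 - x))\<close> and grows like \<open>exp (const \<cdot> sqrt z)\<close>; the choice of \<open>z\<close> of order
  \<open>n\<close> to the power \<open>2/3\<close> gives at least \<open>exp (c n powr (1/3))\<close>.

  Since \<open>B(f) \<le> n^N\<close>, the event \<open>B(f) \<ge> \<xi>\<close> forces \<open>N\<close> to be a large multiple of
  \<open>n powr (1/3) / ln n ^ 3\<close>, and Markov's inequality for \<open>2^N\<close> makes this exponentially unlikely.
  A union bound over the first trials finishes the proof.\<close>

subsection \<open>Cycles of permutations\<close>

lemma sum_Pow_card: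
  fixes h :: "nat \<Rightarrow> 'b::semiring_1"
  assumes "finite A"
  shows "(\<Sum>D\<in>Pow A. h (card D)) = (\<Sum>d\<le>card A. of_nat (card A choose d) * h d)"
proof -
  have "(\<Sum>D\<in>Pow A. h (card D)) = (\<Sum>d\<le>card A. \<Sum>D\<in>{D \<in> Pow A. card D = d}. h (card D))"
    by (rule sum.group[symmetric]) (use assms in \<open>auto intro: card_mono\<close>)
  also have "\<dots> = (\<Sum>d\<le>card A. of_nat (card A choose d) * h d)"
    by (rule sum.cong) (use assms in \<open>auto simp: n_subsets\<close>)
  finally show ?thesis .
qed

lemma cyclic_on_eq:
  assumes "cyclic_on f S" "cyclic_on f T" "x \<in> S" "x \<in> T"
  shows "S = T"
  using assms by (metis orbit_cyclic_eq3)

text \<open>The ground set is an arbitrary \<open>A\<close>, so that cycles can also be listed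
  inside invariant subsets; \<open>mapping_cycles n f\<close> is the case
  \<open>{1..n}\<close>.\<close>

definition cycles_in :: "('a \<Rightarrow> 'a) \<Rightarrow> 'a set \<Rightarrow> 'a set set" where
  "cycles_in f A = {C. C \<subseteq> A \<and> cyclic_on f C}"

lemma finite_cycles_in: "finite A \<Longrightarrow> finite (cycles_in f A)"
  by (rule finite_subset[of _ "Pow A"]) (auto simp: cycles_in_def)

lemma cycles_in_cong: "(\<And>x. x \<in> A \<Longrightarrow> f x = g x) \<Longrightarrow> cycles_in f A = cycles_in g A"
  unfolding cycles_in_def by (rule Collect_cong) (use cyclic_cong[of _ f g] in blast)

text \<open>A surjection of a finite set onto itself is a bijection. Continued by the identity
  outside \<open>A\<close>, \<open>f\<close> becomes a permutation, and every point of
  \<open>A\<close> lies in its own orbit, which is a cycle inside \<open>A\<close>.\<close>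

lemma Union_cycles_in:
  assumes "finite A" "f ` A = A"
  shows "\<Union> (cycles_in f A) = A"
proof
  show "\<Union> (cycles_in f A) \<subseteq> A" by (auto simp: cycles_in_def)
  show "A \<subseteq> \<Union> (cycles_in f A)"
  proof
    fix x assume x: "x \<in> A"
    have "bij_betw f A A"
      using assms by (simp add: bij_betw_def finite_surj_inj)
    then have "bij_betw (perm_restrict f A) A A"
      by (subst bij_betw_cong[where g = f]) (auto simp: perm_restrict_def)
    then have p: "perm_restrict f A permutes A"
      by (rule bij_imp_permutes) (simp add: perm_restrict_def)
    let ?C = "orbit (perm_restrict f A) x"
    have sub: "?C \<subseteq> A" by (rule permutes_orbit_subset[OF p x])
    have "cyclic_on (perm_restrict f A) ?C" by (rule cyclic_on_orbit[OF p assms(1)])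
    then have "cyclic_on f ?C"
      using cyclic_cong[of ?C "perm_restrict f A" f] sub by (simp add: perm_restrict_def subset_iff)
    moreover have "x \<in> ?C"
      by (rule permutation_self_in_orbit) (use p assms(1) in \<open>auto simp: permutation_permutes\<close>)
    ultimately show "x \<in> \<Union> (cycles_in f A)"
      using sub by (auto simp: cycles_in_def)
  qed
qed

lemma image_Union_cycles:
  assumes "\<C> \<subseteq> cycles_in f A"
  shows "f ` \<Union>\<C> = \<Union>\<C>"
proof -
  have "f ` C = C" if "C \<in> \<C>" for C
  proof -
    have c: "cyclic_on f C" using that assms by (auto simp: cycles_in_def)
    have "C \<subseteq> f ` C"
    proof
      fix x assume "x \<in> C"
      then have "x \<in> orbit f x" using c orbit_cyclic_eq3 by fastforce
      then show "x \<in> f ` C"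
      proof cases
        case base
        then show ?thesis using \<open>x \<in> C\<close> by blast
      next
        case (step y)
        then show ?thesis using \<open>x \<in> C\<close> c orbit_cyclic_eq3 by fastforce
      qed
    qed
    then show ?thesis using cyclic_on_inI[OF c] by blast
  qed
  then show ?thesis by (simp add: image_Union)
qed

lemma cycles_in_Union:
  assumes "\<C> \<subseteq> cycles_in f A"
  shows "cycles_in f (\<Union>\<C>) = \<C>"
proof
  show "\<C> \<subseteq> cycles_in f (\<Union>\<C>)" using assms by (auto simp: cycles_in_def)
  show "cycles_in f (\<Union>\<C>) \<subseteq> \<C>"
  proof
    fix C assume "C \<in> cycles_in f (\<Union>\<C>)"
    then have C: "C \<subseteq> \<Union>\<C>" "cyclic_on f C" by (auto simp: cycles_in_def)
    then obtain x where "x \<in> C" by (auto simp: cyclic_on_alldef)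
    then obtain D where "x \<in> D" "D \<in> \<C>" using C by auto
    moreover have "cyclic_on f D" using \<open>D \<in> \<C>\<close> assms by (auto simp: cycles_in_def)
    ultimately show "C \<in> \<C>" using cyclic_on_eq[OF C(2)] \<open>x \<in> C\<close> by blast
  qed
qed

text \<open>Two cycles that share a point coincide, so a set of cycles can be recovered from its
  union; \<open>cycles_in f\<close> is the inverse map.\<close>

lemma bij_betw_cycle_sets:
  assumes "finite A"
  shows "bij_betw Union (Pow (cycles_in f A)) {D. D \<subseteq> A \<and> f ` D = D}"
proof (rule bij_betw_byWitness[where f' = "cycles_in f"])
  show "\<forall>\<C>\<in>Pow (cycles_in f A). cycles_in f (\<Union>\<C>) = \<C>"
    using cycles_in_Union by blast
  show "\<forall>D\<in>{D. D \<subseteq> A \<and> f ` D = D}. \<Union> (cycles_in f D) = D"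
    using Union_cycles_in finite_subset[OF _ assms] by blast
  show "Union ` Pow (cycles_in f A) \<subseteq> {D. D \<subseteq> A \<and> f ` D = D}"
  proof (rule image_subsetI)
    fix \<C> assume s: "\<C> \<in> Pow (cycles_in f A)"
    then have "\<Union>\<C> \<subseteq> A" by (auto simp: cycles_in_def)
    moreover have "f ` \<Union>\<C> = \<Union>\<C>" using s by (intro image_Union_cycles) auto
    ultimately show "\<Union>\<C> \<in> {D. D \<subseteq> A \<and> f ` D = D}" by blast
  qed
  show "cycles_in f ` {D. D \<subseteq> A \<and> f ` D = D} \<subseteq> Pow (cycles_in f A)"
    by (auto simp: cycles_in_def)
qed

text \<open>Multiplying out the right side amounts to choosing a set of cycles, and its union is the
  invariant set \<open>D\<close> that indexes the term. Weight 1 gives a power of two; weight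
  \<open>card C - 1\<close> gives the product of the cycle lengths.\<close>

lemma sum_invariant_subsets:
  fixes w :: "'a set \<Rightarrow> 'b::comm_semiring_1"
  assumes "finite A"
  shows "(\<Sum>D | D \<subseteq> A \<and> f ` D = D. \<Prod>C\<in>cycles_in f D. w C) = (\<Prod>C\<in>cycles_in f A. w C + 1)"
proof -
  have "(\<Prod>C\<in>cycles_in f A. w C + 1) = (\<Sum>\<C>\<in>Pow (cycles_in f A). \<Prod>C\<in>\<C>. w C)"
    using prod_add[OF finite_cycles_in[OF assms], of w "\<lambda>_. 1" f] by simp
  also have "\<dots> = (\<Sum>\<C>\<in>Pow (cycles_in f A). \<Prod>C\<in>cycles_in f (\<Union>\<C>). w C)"
    by (rule sum.cong) (simp_all add: cycles_in_Union)
  also have "\<dots> = (\<Sum>D | D \<subseteq> A \<and> f ` D = D. \<Prod>C\<in>cycles_in f D. w C)"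
    by (rule sum.reindex_bij_betw[OF bij_betw_cycle_sets[OF assms]])
  finally show ?thesis ..
qed

lemma cycles_in_Un:
  assumes "cyclic_on f C" "C \<inter> D = {}"
  shows "cycles_in f (C \<union> D) = insert C (cycles_in f D)"
proof
  show "insert C (cycles_in f D) \<subseteq> cycles_in f (C \<union> D)"
    using assms by (auto simp: cycles_in_def)
  show "cycles_in f (C \<union> D) \<subseteq> insert C (cycles_in f D)"
  proof
    fix K assume K: "K \<in> cycles_in f (C \<union> D)"
    show "K \<in> insert C (cycles_in f D)"
    proof (cases "K \<inter> C = {}")
      case True
      then show ?thesis using K by (auto simp: cycles_in_def)
    next
      case False
      then have "K = C" using K assms(1) by (auto simp: cycles_in_def dest: cyclic_on_eq)
      then show ?thesis by simp
    qed
  qed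
qed

text \<open>Composing with the transposition inserts \<open>x\<close> into the cycle immediately
  before \<open>b\<close>: the predecessor \<open>c\<close> of \<open>b\<close> now goes to
  \<open>x\<close>, and \<open>x\<close> goes to \<open>b\<close>.\<close>

lemma cyclic_on_insert_transpose:
  assumes c: "cyclic_on p S" and p: "p permutes S" and x: "x \<notin> S" and b: "b \<in> S"
  shows "cyclic_on (Transposition.transpose x b \<circ> p) (insert x S)"
proof -
  define q where "q = Transposition.transpose x b \<circ> p"
  have px: "p x = x" using p x by (simp add: permutes_def)
  have qx: "q x = b" by (simp add: q_def px)
  obtain c where c': "c \<in> S" "p c = b" using p b by (metis permutes_image imageE)
  have qc: "q c = x" using c' by (simp add: q_def)
  have other: "q y = p y" if "y \<in> S" "y \<noteq> c" for y
  proof -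
    have "p y \<noteq> b" using that c' p by (metis permutes_inj injD)
    moreover have "p y \<noteq> x" using that p x by (metis permutes_in_image)
    ultimately show ?thesis by (simp add: q_def)
  qed
  \<comment> \<open>Along the old cycle only the step from \<open>c\<close> to \<open>b\<close> is
    lost, and \<open>b\<close> is reached from \<open>x\<close> directly.\<close>
  have 1: "y \<in> orbit q x" if "y \<in> orbit p b" for y
    using that
  proof induction
    case base
    have bx: "b \<in> orbit q x" using orbit.base[of q x] qx by simp
    show ?case
    proof (cases "b = c")
      case True
      then show ?thesis using bx c' unfolding True by metis
    next
      case False
      then show ?thesis using orbit.step[OF bx] other[OF b] by simp
    qed
  next
    case (step y)
    have yS: "y \<in> S" using step(1) c b by (metis orbit_cyclic_eq3)
    show ?case
    proof (cases "y = c")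
      case True
      then show ?thesis using orbit.base[of q x] qx c' by simp
    next
      case False
      then show ?thesis using orbit.step[OF step(2)] other[OF yS] by simp
    qed
  qed
  have S: "S \<subseteq> orbit q x" using 1 orbit_cyclic_eq3[OF c b] by blast
  then have "x \<in> orbit q x" using c'(1) orbit.step[of c q x] qc by auto
  moreover have "orbit q x \<subseteq> insert x S"
  proof
    fix y assume "y \<in> orbit q x"
    then show "y \<in> insert x S"
    proof induction
      case base
      then show ?case using qx b by simp
    next
      case (step y)
      then consider "y = x" | "y = c" | "y \<in> S" "y \<noteq> c" by blast
      then show ?case
        by cases (simp_all add: qx qc b other permutes_in_image[OF p])
    qed
  qed
  ultimately have "insert x S = orbit q x" using S by auto
  then show ?thesis unfolding cyclic_on_def q_def[symmetric] by blast
qed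

text \<open>The point \<open>a\<close> is split off so that the count is
  \<open>fact (card D)\<close> without a predecessor. In the induction a new point can be inserted
  before any of the \<open>card D + 1\<close> old ones, and different choices give different
  permutations.\<close>

lemma card_cyclic_permutations_ge:
  assumes "finite D" "a \<notin> D"
  shows "fact (card D) \<le> card {p. p permutes insert a D \<and> cyclic_on p (insert a D)}"
  using assms
proof (induction D rule: finite_induct)
  case empty
  have "id \<in> {p. p permutes {a} \<and> cyclic_on p {a}}"
    using orbit_eq_singleton_iff[of id a] by (auto simp: cyclic_on_def permutes_id)
  then have "card {p. p permutes {a} \<and> cyclic_on p {a}} \<noteq> 0"
    using finite_permutations[of "{a}"] by (subst card_eq_0_iff) auto
  then show ?case by (simp only: card.empty fact_0)
next
  case (insert x D)
  let ?S = "insert a D"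
  let ?P = "{p. p permutes ?S \<and> cyclic_on p ?S}"
  let ?Q = "{p. p permutes insert x ?S \<and> cyclic_on p (insert x ?S)}"
  let ?h = "\<lambda>(b, p). Transposition.transpose x b \<circ> p"
  have x: "x \<notin> ?S" using insert by auto
  have fin: "finite {p. p permutes insert x ?S}" using insert by (intro finite_permutations) auto
  have inj: "inj_on ?h (?S \<times> ?P)"
  proof (rule inj_onI)
    fix u v assume u: "u \<in> ?S \<times> ?P" and v: "v \<in> ?S \<times> ?P" and h: "?h u = ?h v"
    obtain b p where up: "u = (b, p)" by (cases u)
    obtain b' p' where vp: "v = (b', p')" by (cases v)
    have eq: "Transposition.transpose x b (p y) = Transposition.transpose x b' (p' y)" for y
      using fun_cong[OF h, of y] up vp by simp
    \<comment> \<open>Both permutations fix \<open>x\<close>, so the value of the composition at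
      \<open>x\<close> identifies \<open>b\<close>; cancelling the transposition then identifies
      \<open>p\<close>.\<close>
    have "p x = x" "p' x = x" using u v up vp x by (auto simp: permutes_def)
    then have bb: "b = b'" using eq[of x] by simp
    have "p y = p' y" for y
      using eq[of y] bb by (metis transpose_involutory)
    then show "u = v" using bb up vp by blast
  qed
  have sub: "?h ` (?S \<times> ?P) \<subseteq> ?Q"
  proof (rule image_subsetI)
    fix u assume "u \<in> ?S \<times> ?P"
    then obtain b p where u: "u = (b, p)" and b: "b \<in> ?S" and p: "p permutes ?S" "cyclic_on p ?S" by blast
    have "p permutes insert x ?S" using p(1) by (rule permutes_subset) blast
    moreover have "Transposition.transpose x b permutes insert x ?S"
      using b by (intro permutes_swap_id) blast+
    ultimately have "Transposition.transpose x b \<circ> p permutes insert x ?S"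
      by (rule permutes_compose)
    with cyclic_on_insert_transpose[OF p(2,1) x b] show "?h u \<in> ?Q" unfolding u by simp
  qed
  have "fact (card (insert x D)) = card ?S * fact (card D)"
    using insert by simp
  also have "\<dots> \<le> card ?S * card ?P" using insert by (intro mult_le_mono2) auto
  also have "\<dots> = card (?h ` (?S \<times> ?P))" by (simp only: card_image[OF inj] card_cartesian_product)
  also have "\<dots> \<le> card ?Q" by (rule card_mono[OF _ sub]) (rule finite_subset[OF _ fin], auto)
  finally show ?case by (simp add: insert_commute)
qed

section \<open>Permutations weighted by their cycle lengths\<close>

definition cycle_weight_sum :: "'a set \<Rightarrow> real" where
  "cycle_weight_sum A = (\<Sum>\<pi> | \<pi> permutes A. \<Prod>C\<in>cycles_in \<pi> A. real (card C) - 1)"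

lemma prod_cycle_weight_nonneg: "finite A \<Longrightarrow> 0 \<le> (\<Prod>C\<in>cycles_in f A. real (card C) - 1)"
proof (rule prod_nonneg)
  fix C assume "finite A" "C \<in> cycles_in f A"
  then have "finite C" "C \<noteq> {}" by (auto simp: cycles_in_def cyclic_on_alldef finite_subset)
  then have "0 < card C" by (simp add: card_gt_0_iff)
  then show "0 \<le> real (card C) - 1" by simp
qed

text \<open>A permutation of \<open>insert a A\<close> is assembled from the set \<open>D\<close> of
  the other points on the cycle of \<open>a\<close>, a cyclic permutation of
  \<open>insert a D\<close> and a permutation of the rest. The cycle of \<open>a\<close> has weight
  \<open>card D\<close> and can be chosen in at least \<open>fact (card D)\<close> ways.\<close>

lemma cycle_weight_sum_insert_ge:
  assumes fin: "finite A" and a: "a \<notin> A"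
  shows "(\<Sum>D\<in>Pow A. real (card D) * fact (card D) * cycle_weight_sum (A - D))
           \<le> cycle_weight_sum (insert a A)"
proof -
  let ?w = "\<lambda>C. real (card C) - 1"
  let ?R = "\<lambda>D. {\<rho>. \<rho> permutes insert a D \<and> cyclic_on \<rho> (insert a D)}"
  let ?S = "\<lambda>D. {\<sigma>. \<sigma> permutes A - D}"
  let ?I = "SIGMA D:Pow A. ?R D \<times> ?S D"
  let ?h = "\<lambda>(D, \<rho>, \<sigma>). \<rho> \<circ> \<sigma>"
  have finR: "finite (?R D)" if "D \<in> Pow A" for D
    by (rule finite_subset[OF _ finite_permutations[of "insert a D"]]) (use that fin in \<open>auto intro: finite_subset\<close>)
  have finS: "finite (?S D)" for D
    using fin by (intro finite_permutations) auto
  have onD: "(\<rho> \<circ> \<sigma>) y = \<rho> y" if "\<sigma> permutes A - D" "y \<in> insert a D" for D \<rho> \<sigma> y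
    using that a by (auto simp: permutes_def)
  have offD: "(\<rho> \<circ> \<sigma>) y = \<sigma> y" if "\<rho> permutes insert a D" "\<sigma> permutes A - D" "y \<notin> insert a D" for D \<rho> \<sigma> y
  proof -
    have "\<sigma> y \<notin> insert a D"
      using that a by (metis DiffD2 DiffD1 insert_iff permutes_in_image permutes_not_in)
    then show ?thesis using that by (auto simp: permutes_def)
  qed
  have cyc: "cyclic_on (\<rho> \<circ> \<sigma>) (insert a D)"
    if "\<rho> \<in> ?R D" "\<sigma> \<in> ?S D" for D \<rho> \<sigma>
    using that cyclic_cong[of "insert a D" "\<rho> \<circ> \<sigma>" \<rho>] onD[of \<sigma> D] by auto
  have inj: "inj_on ?h ?I"
  proof (rule inj_onI)
    fix u v assume u: "u \<in> ?I" and v: "v \<in> ?I" and h: "?h u = ?h v"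
    obtain D \<rho> \<sigma> where up: "u = (D, \<rho>, \<sigma>)" by (cases u)
    obtain D' \<rho>' \<sigma>' where vp: "v = (D', \<rho>', \<sigma>')" by (cases v)
    have D: "D \<subseteq> A" "D' \<subseteq> A"
      and r: "\<rho> permutes insert a D" "cyclic_on \<rho> (insert a D)" "\<sigma> permutes A - D"
      and r': "\<rho>' permutes insert a D'" "cyclic_on \<rho>' (insert a D')" "\<sigma>' permutes A - D'"
      and eq: "\<rho> \<circ> \<sigma> = \<rho>' \<circ> \<sigma>'"
      using u v h up vp by simp_all
    \<comment> \<open>\<open>D\<close> can be recovered from the composition because
      \<open>insert a D\<close> is its cycle through \<open>a\<close>.\<close>
    have "insert a D = insert a D'"
      using cyc[of \<rho> D \<sigma>] cyc[of \<rho>' D' \<sigma>'] r r' eq cyclic_on_eq[of "\<rho> \<circ> \<sigma>" "insert a D" "insert a D'" a] by auto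
    then have DD: "D = D'" using insert_ident[of a D D'] D a by auto
    have "\<rho> y = \<rho>' y" for y
    proof (cases "y \<in> insert a D")
      case True
      then show ?thesis using onD r(3) r'(3) DD eq by metis
    next
      case False
      then show ?thesis using r(1) r'(1) DD by (auto simp: permutes_def)
    qed
    moreover have "\<sigma> y = \<sigma>' y" for y
    proof (cases "y \<in> insert a D")
      case False
      then show ?thesis using offD[OF r(1,3)] offD[OF r'(1,3)] DD eq by metis
    next
      case True
      then have "y \<notin> A - D" using a by auto
      then show ?thesis using r(3) r'(3) DD by (auto simp: permutes_def)
    qed
    ultimately show "u = v" using DD up vp by blast
  qed
  have sub: "?h ` ?I \<subseteq> {\<pi>. \<pi> permutes insert a A}"
  proof (rule image_subsetI)
    fix u assume u: "u \<in> ?I"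
    obtain D \<rho> \<sigma> where up: "u = (D, \<rho>, \<sigma>)" by (cases u)
    have D: "D \<subseteq> A" and r: "\<rho> permutes insert a D" "\<sigma> permutes A - D"
      using u up by simp_all
    have "\<rho> \<circ> \<sigma> permutes insert a A"
      by (rule permutes_compose[OF permutes_subset[OF r(2)] permutes_subset[OF r(1)]]) (use D in auto)
    then show "?h u \<in> {\<pi>. \<pi> permutes insert a A}" using up by simp
  qed
  have weight: "(\<Prod>C\<in>cycles_in (\<rho> \<circ> \<sigma>) (insert a A). ?w C)
      = real (card D) * (\<Prod>C\<in>cycles_in \<sigma> (A - D). ?w C)"
    if D: "D \<subseteq> A" and r: "\<rho> \<in> ?R D" "\<sigma> \<in> ?S D" for D \<rho> \<sigma>
  proof -
    have A: "insert a A = insert a D \<union> (A - D)" using D by auto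
    have dis: "insert a D \<inter> (A - D) = {}" using a by auto
    have "cycles_in (\<rho> \<circ> \<sigma>) (A - D) = cycles_in \<sigma> (A - D)"
      by (rule cycles_in_cong) (rule offD[of _ D], use r a in auto)
    then have "cycles_in (\<rho> \<circ> \<sigma>) (insert a A) = insert (insert a D) (cycles_in \<sigma> (A - D))"
      unfolding A using cycles_in_Un[OF cyc[OF r] dis] by simp
    moreover have "insert a D \<notin> cycles_in \<sigma> (A - D)" using a by (auto simp: cycles_in_def)
    moreover have "finite (cycles_in \<sigma> (A - D))" using fin by (intro finite_cycles_in) auto
    moreover have "card (insert a D) = Suc (card D)"
      using D fin a by (subst card_insert_disjoint) (auto intro: finite_subset)
    ultimately show ?thesis by simp
  qed
  have "(\<Sum>D\<in>Pow A. real (card D) * fact (card D) * cycle_weight_sum (A - D))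
      \<le> (\<Sum>D\<in>Pow A. real (card (?R D)) * (real (card D) * cycle_weight_sum (A - D)))"
  proof (rule sum_mono)
    fix D assume D: "D \<in> Pow A"
    have f: "fact (card D) \<le> card (?R D)"
      by (rule card_cyclic_permutations_ge) (use D fin a in \<open>auto intro: finite_subset\<close>)
    have "(fact (card D) :: real) \<le> real (card (?R D))"
      using f by (metis of_nat_fact of_nat_le_iff)
    moreover have "0 \<le> real (card D) * cycle_weight_sum (A - D)"
      unfolding cycle_weight_sum_def using fin
      by (intro mult_nonneg_nonneg sum_nonneg prod_cycle_weight_nonneg) auto
    ultimately have "fact (card D) * (real (card D) * cycle_weight_sum (A - D))
        \<le> real (card (?R D)) * (real (card D) * cycle_weight_sum (A - D))"
      by (rule mult_right_mono)
    then show "real (card D) * fact (card D) * cycle_weight_sum (A - D)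
        \<le> real (card (?R D)) * (real (card D) * cycle_weight_sum (A - D))"
      by (simp add: mult_ac)
  qed
  also have "\<dots> = (\<Sum>D\<in>Pow A. \<Sum>(\<rho>, \<sigma>)\<in>?R D \<times> ?S D. real (card D) * (\<Prod>C\<in>cycles_in \<sigma> (A - D). ?w C))"
    by (simp add: sum.cartesian_product[symmetric] cycle_weight_sum_def sum_distrib_left)
  also have "\<dots> = (\<Sum>D\<in>Pow A. \<Sum>(\<rho>, \<sigma>)\<in>?R D \<times> ?S D. \<Prod>C\<in>cycles_in (\<rho> \<circ> \<sigma>) (insert a A). ?w C)"
    by (intro sum.cong refl) (auto simp: weight)
  also have "\<dots> = (\<Sum>(D, \<rho>, \<sigma>)\<in>?I. \<Prod>C\<in>cycles_in (\<rho> \<circ> \<sigma>) (insert a A). ?w C)"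
    using fin finR finS by (subst sum.Sigma) (auto simp: case_prod_unfold)
  also have "\<dots> = (\<Sum>\<pi>\<in>?h ` ?I. \<Prod>C\<in>cycles_in \<pi> (insert a A). ?w C)"
    by (subst sum.reindex[OF inj]) (auto simp: case_prod_unfold)
  also have "\<dots> \<le> cycle_weight_sum (insert a A)"
    unfolding cycle_weight_sum_def using fin
    by (intro sum_mono2 sub finite_permutations prod_cycle_weight_nonneg) auto
  finally show ?thesis .
qed

text \<open>The recursion comes from removing the cycle through a given point, which has length \<open>d + 1\<close>
  and weight \<open>d\<close>.\<close>

fun weight_coeff :: "nat \<Rightarrow> real" where
  "weight_coeff 0 = 1"
| "weight_coeff (Suc z) = (\<Sum>d\<le>z. real d * weight_coeff (z - d)) / real (Suc z)"

text \<open>Induction by removing the cycle through one point. As \<open>fact z\<close> is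
  \<open>z choose d\<close> times \<open>fact d * fact (z - d)\<close>, grouping the sets
  \<open>D\<close> by size turns \<open>cycle_weight_sum_insert_ge\<close> into the recursion of
  \<open>weight_coeff\<close>.\<close>

lemma cycle_weight_sum_ge:
  assumes "finite A"
  shows "fact (card A) * weight_coeff (card A) \<le> cycle_weight_sum A"
  using assms
proof (induction A rule: finite_psubset_induct)
  case (psubset A)
  show ?case
  proof (cases "A = {}")
    case True
    \<comment> \<open>The empty set is not a cycle, so the only permutation of \<open>{}\<close>
      contributes the empty product 1, which is \<open>weight_coeff 0\<close>.\<close>
    have "cycles_in id {} = ({} :: 'a set set)" by (auto simp: cycles_in_def cyclic_on_alldef)
    then show ?thesis using True by (simp add: cycle_weight_sum_def permutes_empty)
  next
    case False
    then obtain a B where A: "A = insert a B" "a \<notin> B" by (metis Set.set_insert ex_in_conv)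
    have B: "finite B" using A psubset by auto
    let ?z = "card B"
    have "fact (card A) * weight_coeff (card A)
        = fact ?z * (\<Sum>d\<le>?z. real d * weight_coeff (?z - d))"
      using A B by (simp add: field_simps)
    also have "\<dots> = (\<Sum>d\<le>?z. real (?z choose d) *
         (real d * fact d * (fact (?z - d) * weight_coeff (?z - d))))"
      unfolding sum_distrib_left
    proof (rule sum.cong)
      fix d assume "d \<in> {..?z}"
      then have "fact ?z = fact d * fact (?z - d) * real (?z choose d)"
        using binomial_fact_lemma[of d ?z] by (metis atMost_iff of_nat_fact of_nat_mult)
      then show "fact ?z * (real d * weight_coeff (?z - d)) = real (?z choose d) *
         (real d * fact d * (fact (?z - d) * weight_coeff (?z - d)))" by simp
    qed simp
    also have "\<dots> = (\<Sum>D\<in>Pow B. real (card D) * fact (card D) *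
        (fact (?z - card D) * weight_coeff (?z - card D)))"
      by (rule sum_Pow_card[OF B, symmetric])
    also have "\<dots> \<le> (\<Sum>D\<in>Pow B. real (card D) * fact (card D) * cycle_weight_sum (B - D))"
    proof (rule sum_mono)
      fix D assume D: "D \<in> Pow B"
      then have "card (B - D) = ?z - card D"
        using B by (auto intro!: card_Diff_subset intro: finite_subset)
      moreover have "B - D \<subset> A" using A by auto
      ultimately have "fact (?z - card D) * weight_coeff (?z - card D) \<le> cycle_weight_sum (B - D)"
        using psubset(2)[of "B - D"] by simp
      then show "real (card D) * fact (card D) * (fact (?z - card D) * weight_coeff (?z - card D))
        \<le> real (card D) * fact (card D) * cycle_weight_sum (B - D)"
        by (rule mult_left_mono) simp
    qed
    also have "\<dots> \<le> cycle_weight_sum A"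
      unfolding A(1) by (rule cycle_weight_sum_insert_ge[OF B A(2)])
    finally show ?thesis .
  qed
qed

subsection \<open>Mappings with prescribed values\<close>

lemma finite_zero_k_mappings: "finite (zero_k_mappings k n)"
  unfolding zero_k_mappings_def by (rule finite_subset[OF _ finite_PiE[of "{1..n}" "\<lambda>_. {1..n}"]]) auto

text \<open>This makes the uniform distribution on the mappings meaningful.\<close>

lemma zero_k_mappings_nonempty:
  assumes "k dvd n" "k > 0"
  shows "zero_k_mappings k n \<noteq> {}"
proof -
  obtain m where n: "n = k * m" using assms by auto
  \<comment> \<open>Consecutive blocks of length \<open>k\<close> are collapsed to their indices:
    the values up to \<open>m\<close> have \<open>k\<close> preimages each, larger values have
    none.\<close>
  define f where "f = (\<lambda>x\<in>{1..n}. (x - 1) div k + 1)"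
  have "f \<in> {1..n} \<rightarrow>\<^sub>E {1..n}"
  proof
    fix x assume x: "x \<in> {1..n}"
    have "(x - 1) div k \<le> x - 1" by simp
    then have "(x - 1) div k + 1 \<le> n" using x by (auto simp del: div_le_dividend)
    then show "f x \<in> {1..n}" using x by (simp add: f_def)
  qed (auto simp: f_def)
  moreover have "card {x \<in> {1..n}. f x = y} \<in> {0, k}" if "y \<in> {1..n}" for y
  proof (cases "y \<le> m")
    case True
    have y: "y \<ge> 1" using that by simp
    have "{x \<in> {1..n}. f x = y} = {k * (y - 1) + 1..k * (y - 1) + k}"
    proof (intro set_eqI iffI)
      fix x assume x: "x \<in> {x \<in> {1..n}. f x = y}"
      then have "(x - 1) div k = y - 1" "x \<ge> 1" by (auto simp: f_def)
      then show "x \<in> {k * (y - 1) + 1..k * (y - 1) + k}"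
        using div_mult_mod_eq[of "x - 1" k] mod_less_divisor[OF assms(2), of "x - 1"]
        by (auto simp: mult.commute)
    next
      fix x assume x: "x \<in> {k * (y - 1) + 1..k * (y - 1) + k}"
      have "k * (y - 1) + k = k * y" using y by (cases y) auto
      also have "\<dots> \<le> n" using True n by simp
      finally have le: "x \<le> n" using x by simp
      have "(x - 1) div k = y - 1"
        using x assms(2) by (intro div_nat_eqI) (auto simp: algebra_simps)
      then show "x \<in> {x \<in> {1..n}. f x = y}" using x le y by (auto simp: f_def)
    qed
    then show ?thesis by simp
  next
    case False
    have "{x \<in> {1..n}. f x = y} = {}"
    proof -
      have "f x < m + 1" if "x \<in> {1..n}" for x
        using that assms(2) n by (auto simp: f_def less_mult_imp_div_less mult.commute)
      then show ?thesis using False by fastforce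
    qed
    then show ?thesis by simp
  qed
  ultimately have "f \<in> zero_k_mappings k n" by (simp add: zero_k_mappings_def)
  then show ?thesis by blast
qed

definition extensions :: "nat \<Rightarrow> nat \<Rightarrow> nat set \<Rightarrow> (nat \<Rightarrow> nat) \<Rightarrow> (nat \<Rightarrow> nat) set" where
  "extensions k n A g = {f \<in> zero_k_mappings k n. \<forall>a\<in>A. f a = g a}"

lemma finite_extensions: "finite (extensions k n A g)"
  unfolding extensions_def using finite_zero_k_mappings by auto

text \<open>Relabelling the points outside \<open>A\<close> and the values outside \<open>g ` A\<close> independently preserves
  the class of \<open>{0,k}\<close>-mappings, so all pairs \<open>(a, b)\<close> are equally likely.\<close>

lemma card_extensions_insert_le:
  assumes "A \<subseteq> {1..n}" "g ` A \<subseteq> {1..n}"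
    and a: "a \<in> {1..n} - A" "a' \<in> {1..n} - A" and b: "b \<in> {1..n} - g ` A" "b' \<in> {1..n} - g ` A"
  shows "card {f \<in> extensions k n A g. f a = b} \<le> card {f \<in> extensions k n A g. f a' = b'}"
proof -
  let ?s = "Transposition.transpose a a'" and ?t = "Transposition.transpose b b'"
  have s: "?s permutes {1..n}" and t: "?t permutes {1..n}"
    using a b by (auto intro: permutes_swap_id)
  \<comment> \<open>\<open>?s\<close> fixes the points of \<open>A\<close> and \<open>?t\<close>
    fixes their prescribed values, so these survive; the restriction to \<open>{1..n}\<close> keeps
    \<open>h f\<close> extensional.\<close>
  define h where "h f = (\<lambda>x\<in>{1..n}. ?t (f (?s x)))" for f :: "nat \<Rightarrow> nat"
  have sn: "?s x \<in> {1..n} \<longleftrightarrow> x \<in> {1..n}" and tn: "?t x \<in> {1..n} \<longleftrightarrow> x \<in> {1..n}" for x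
    by (rule permutes_in_image[OF s], rule permutes_in_image[OF t])
  show ?thesis
  proof (rule card_inj_on_le[where f = h])
    show "inj_on h {f \<in> extensions k n A g. f a = b}"
    proof (rule inj_onI, rule ext)
      fix f f' x
      assume f: "f \<in> {f \<in> extensions k n A g. f a = b}" "f' \<in> {f \<in> extensions k n A g. f a = b}" and eq: "h f = h f'"
      show "f x = f' x"
      proof (cases "x \<in> {1..n}")
        case True
        then have "?s x \<in> {1..n}" using sn by blast
        then have "?t (f x) = ?t (f' x)"
          using fun_cong[OF eq, of "?s x"] by (simp add: h_def)
        then show ?thesis by (metis transpose_involutory)
      next
        case False
        then show ?thesis using f by (auto simp: extensions_def zero_k_mappings_def PiE_def extensional_def)
      qed
    qed
    show "h ` {f \<in> extensions k n A g. f a = b} \<subseteq> {f \<in> extensions k n A g. f a' = b'}"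
    proof clarify
      fix f assume f: "f \<in> extensions k n A g" and fa: "b = f a"
      have fn: "f x \<in> {1..n}" if "x \<in> {1..n}" for x
        using f that by (auto simp: extensions_def zero_k_mappings_def)
      have "h f \<in> {1..n} \<rightarrow>\<^sub>E {1..n}"
        unfolding h_def by (rule restrict_PiE[THEN iffD2]) (use sn tn fn in blast)
      moreover have "card {x \<in> {1..n}. h f x = y} \<in> {0, k}" if y: "y \<in> {1..n}" for y
      proof -
        have "{x \<in> {1..n}. h f x = y} = ?s ` {x \<in> {1..n}. f x = ?t y}"
        proof (intro set_eqI iffI)
          fix x assume x: "x \<in> {x \<in> {1..n}. h f x = y}"
          then have "f (?s x) = ?t y" by (auto simp: h_def)
          then show "x \<in> ?s ` {x \<in> {1..n}. f x = ?t y}"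
            using x sn[of x] by (intro image_eqI[of _ _ "?s x"]) auto
        next
          fix x assume "x \<in> ?s ` {x \<in> {1..n}. f x = ?t y}"
          then obtain u where "x = ?s u" "u \<in> {1..n}" "f u = ?t y" by auto
          then show "x \<in> {x \<in> {1..n}. h f x = y}" using sn[of u] by (auto simp: h_def)
        qed
        then have "card {x \<in> {1..n}. h f x = y} = card {x \<in> {1..n}. f x = ?t y}"
          by (simp only: card_image[OF inj_on_transpose])
        moreover have "?t y \<in> {1..n}" using y tn[of y] by simp
        ultimately show ?thesis using f by (auto simp: extensions_def zero_k_mappings_def)
      qed
      ultimately have "h f \<in> zero_k_mappings k n" by (simp add: zero_k_mappings_def)
      moreover have "h f x = g x" if x: "x \<in> A" for x
      proof -
        have "?s x = x" using x a by (intro transpose_apply_other) auto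
        moreover have "?t (g x) = g x" using x b by (intro transpose_apply_other) auto
        moreover have "f x = g x" using f x by (auto simp: extensions_def)
        moreover have "x \<in> {1..n}" using x assms(1) by auto
        ultimately show ?thesis by (simp add: h_def)
      qed
      moreover have "h f a' = b'" using a fa by (simp add: h_def)
      ultimately show "h f \<in> extensions k n A g \<and> h f a' = b'" by (simp add: extensions_def)
    qed
    show "finite {f \<in> extensions k n A g. f a' = b'}" using finite_extensions by simp
  qed
qed

text \<open>Each of the \<open>card A\<close> prescribed values is attained and hence has exactly
  \<open>k\<close> preimages. These preimage sets are disjoint subsets of \<open>{1..n}\<close> and
  together contain \<open>A\<close>, so the natural subtraction is exact.\<close>

lemma card_free_points:
  assumes f: "f \<in> extensions k n A g" and A: "A \<subseteq> {1..n}" and inj: "inj_on g A" and gA: "g ` A \<subseteq> {1..n}"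
  shows "card {x \<in> {1..n} - A. f x \<notin> g ` A} = n - k * card A"
proof -
  have finA: "finite A" using A finite_subset by blast
  have fz: "f \<in> zero_k_mappings k n" and fA: "\<And>a. a \<in> A \<Longrightarrow> f a = g a" using f by (auto simp: extensions_def)
  let ?P = "\<lambda>y. {x \<in> {1..n}. f x = y}"
  have "card (?P y) = k" if y: "y \<in> g ` A" for y
  proof -
    obtain a where "a \<in> A" "y = g a" using y by blast
    then have "a \<in> ?P y" using A fA by auto
    moreover have "finite (?P y)" by simp
    ultimately have "card (?P y) \<noteq> 0" by (metis card_eq_0_iff empty_iff)
    moreover have "y \<in> {1..n}" using y gA by blast
    ultimately show ?thesis using fz by (auto simp: zero_k_mappings_def)
  qed
  then have "card (\<Union>y\<in>g ` A. ?P y) = k * card (g ` A)"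
    by (subst card_UN_disjoint) (use finA in auto)
  then have c: "card (\<Union>y\<in>g ` A. ?P y) = k * card A" by (simp add: card_image[OF inj])
  have "{x \<in> {1..n} - A. f x \<notin> g ` A} = {1..n} - (\<Union>y\<in>g ` A. ?P y)"
    using fA by auto
  then have "card {x \<in> {1..n} - A. f x \<notin> g ` A} = card {1..n} - card (\<Union>y\<in>g ` A. ?P y)"
    by (simp only:) (rule card_Diff_subset, use finA in auto)
  then show ?thesis by (simp only: c card_atLeastAtMost)
qed

text \<open>Double counting of the triples \<open>(f, x, y)\<close> with \<open>f x = y\<close>,
  \<open>x\<close> outside \<open>A\<close> and \<open>y\<close> not a prescribed value: all
  \<open>(n - card A)\<^sup>2\<close> pairs \<open>(x, y)\<close> occur equally often, and each
  \<open>f\<close> contributes its \<open>n - k * card A\<close> free points.\<close>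

lemma card_extensions_insert:
  assumes A: "A \<subseteq> {1..n}" and inj: "inj_on g A" and gA: "g ` A \<subseteq> {1..n}"
    and a: "a \<in> {1..n} - A" and b: "b \<in> {1..n} - g ` A"
  shows "card {f \<in> extensions k n A g. f a = b} * (n - card A)\<^sup>2 = card (extensions k n A g) * (n - k * card A)"
proof -
  let ?E = "extensions k n A g"
  let ?X = "{1..n} - A" and ?Y = "{1..n} - g ` A"
  have finA: "finite A" using A finite_subset by blast
  have cX: "card ?X = n - card A" using A finA by (simp add: card_Diff_subset)
  have cY: "card ?Y = n - card A" using gA finA by (simp add: card_Diff_subset card_image[OF inj])
  have eq: "card {f \<in> ?E. f x = y} = card {f \<in> ?E. f a = b}" if "x \<in> ?X" "y \<in> ?Y" for x y
    using card_extensions_insert_le[OF A gA a that(1) b that(2)] card_extensions_insert_le[OF A gA that(1) a that(2) b]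
    by (rule antisym[rotated])
  have "(\<Sum>x\<in>?X. \<Sum>y\<in>?Y. card {f \<in> ?E. f x = y}) = (\<Sum>x\<in>?X. \<Sum>y\<in>?Y. card {f \<in> ?E. f a = b})"
    by (intro sum.cong refl eq)
  also have "\<dots> = card {f \<in> ?E. f a = b} * (n - card A)\<^sup>2" by (simp only: sum_constant cX cY power2_eq_square of_nat_id mult_ac)
  finally have l: "(\<Sum>x\<in>?X. \<Sum>y\<in>?Y. card {f \<in> ?E. f x = y}) = card {f \<in> ?E. f a = b} * (n - card A)\<^sup>2" .
  have "(\<Sum>x\<in>?X. \<Sum>y\<in>?Y. card {f \<in> ?E. f x = y}) = (\<Sum>x\<in>?X. \<Sum>y\<in>?Y. \<Sum>f\<in>?E. if f x = y then 1 else 0)"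
    by (intro sum.cong refl) (simp only: card_eq_sum sum.inter_filter[OF finite_extensions])
  also have "\<dots> = (\<Sum>x\<in>?X. \<Sum>f\<in>?E. \<Sum>y\<in>?Y. if f x = y then 1 else 0)"
    by (rule sum.cong[OF refl]) (rule sum.swap)
  also have "\<dots> = (\<Sum>f\<in>?E. \<Sum>x\<in>?X. \<Sum>y\<in>?Y. if f x = y then 1 else 0)"
    by (rule sum.swap)
  also have "\<dots> = (\<Sum>f\<in>?E. \<Sum>x\<in>?X. if f x \<notin> g ` A then 1 else 0)"
  proof (intro sum.cong refl)
    fix f x assume "f \<in> ?E" "x \<in> ?X"
    then have "f x \<in> {1..n}" by (auto simp: extensions_def zero_k_mappings_def)
    then show "(\<Sum>y\<in>?Y. if f x = y then 1 else 0) = (if f x \<notin> g ` A then 1 else 0 :: nat)"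
      by (subst sum.delta') auto
  qed
  also have "\<dots> = (\<Sum>f\<in>?E. card {x \<in> ?X. f x \<notin> g ` A})"
    by (simp only: card_eq_sum) (intro sum.cong refl sum.inter_filter[symmetric], auto)
  also have "\<dots> = (\<Sum>f\<in>?E. n - k * card A)"
    by (intro sum.cong refl card_free_points[OF _ A inj gA])
  finally show ?thesis using l by simp
qed

text \<open>Prescribing the values one after another gives one factor each. Truncated subtraction
  makes a factor vanish once \<open>k * t \<ge> n\<close>, in agreement with the absence of
  extensions.\<close>

lemma card_extensions:
  assumes "A \<subseteq> {1..n}" "inj_on g A" "g ` A \<subseteq> {1..n}"
  shows "real (card (extensions k n A g)) =
    real (card (zero_k_mappings k n)) * (\<Prod>t<card A. real (n - k * t) / (real (n - t))\<^sup>2)"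
proof -
  have "finite A" using assms(1) finite_subset by blast
  then show ?thesis using assms
  proof (induction A rule: finite_induct)
    case empty
    then show ?case by (simp add: extensions_def)
  next
    case (insert a A)
    have "A \<subset> {1..n}" using insert by auto
    then have "card A < n" using psubset_card_mono[of "{1..n}" A] by simp
    then have pos: "(real (n - card A))\<^sup>2 \<noteq> 0" by simp
    have "extensions k n (insert a A) g = {f \<in> extensions k n A g. f a = g a}"
      by (auto simp: extensions_def)
    moreover have "card {f \<in> extensions k n A g. f a = g a} * (n - card A)\<^sup>2
        = card (extensions k n A g) * (n - k * card A)"
      by (rule card_extensions_insert) (use insert in auto)
    ultimately have "real (card (extensions k n (insert a A) g)) * (real (n - card A))\<^sup>2
        = real (card (extensions k n A g)) * real (n - k * card A)"
      by (metis of_nat_mult of_nat_power)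
    then have "real (card (extensions k n (insert a A) g))
        = real (card (extensions k n A g)) * (real (n - k * card A) / (real (n - card A))\<^sup>2)"
      using pos by (simp add: field_simps)
    then show ?case using insert by simp
  qed
qed

subsection \<open>The expected product of the cycle lengths\<close>

lemma weight_coeff_nonneg: "0 \<le> weight_coeff z"
proof (induction z rule: less_induct)
  case (less z)
  then show ?case by (cases z) (auto intro!: sum_nonneg divide_nonneg_nonneg mult_nonneg_nonneg)
qed

text \<open>The last term \<open>d = z - 1\<close> of the recursion is already positive, as
  \<open>weight_coeff 0 = 1\<close>. The bound on \<open>z\<close> excludes
  \<open>weight_coeff 1 = 0\<close>, since a fixed point has weight 0.\<close>

lemma weight_coeff_pos:
  assumes "z \<ge> 2"
  shows "0 < weight_coeff z"
proof -
  obtain y where z: "z = Suc y" "y \<ge> 1" using assms by (cases z) auto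
  have "real y * weight_coeff (y - y) \<le> (\<Sum>d\<le>y. real d * weight_coeff (y - d))"
    by (rule member_le_sum) (auto intro: mult_nonneg_nonneg weight_coeff_nonneg)
  then have "0 < (\<Sum>d\<le>y. real d * weight_coeff (y - d))" using z by simp
  then show ?thesis using z by simp
qed

text \<open>The terms with \<open>d \<le> 2 sqrt z - 1\<close> of the recursion suffice: for them
  \<open>sqrt (z - d - 1) \<ge> sqrt z - 2\<close>, and the weights \<open>d\<close> sum to almost \<open>2 z\<close>.\<close>

lemma weight_coeff_step:
  fixes z :: nat
  assumes z: "z \<ge> 64" and \<alpha>: "\<alpha> > 0"
    and IH: "\<And>m. m \<ge> 2 \<Longrightarrow> m < z \<Longrightarrow> \<alpha> * exp (sqrt m / 16) \<le> weight_coeff m"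
  shows "\<alpha> * exp (sqrt z / 16) \<le> weight_coeff z"
proof -
  obtain y where y: "z = Suc y" using z by (cases z) auto
  define s where "s = sqrt z"
  have ss: "s * s = z" by (simp add: s_def)
  have s8: "s \<ge> 8" unfolding s_def using z by (intro real_le_rsqrt) simp
  define D where "D = nat \<lfloor>2 * s\<rfloor> - 1"
  have Du: "real D + 1 \<le> 2 * s" and Dl: "2 * s - 2 \<le> real D"
    using s8 by (auto simp: D_def of_nat_diff le_nat_iff le_floor_iff) linarith+
  have "8 * s \<le> s * s" using s8 by (intro mult_right_mono) auto
  then have s2: "2 * s + 2 \<le> s * s" using s8 by linarith
  have Dz: "D \<le> y"
  proof -
    have "real D + 1 \<le> real z" using Du s2 ss by linarith
    then show ?thesis using y by simp
  qed
  \<comment> \<open>Replacing \<open>sqrt (y - d)\<close> by \<open>s - 2\<close> costs the factor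
    \<open>exp (- 2 / 16)\<close>, which is at least \<open>7 / 8\<close>.\<close>
  have low: "\<alpha> * exp (s / 16) * (7 / 8) \<le> weight_coeff (y - d)" if d: "d \<le> D" for d
  proof -
    have m: "real (y - d) = s * s - 1 - real d" using d Dz y ss by (simp add: of_nat_diff)
    have "real (y - d) \<ge> 2" using m d Du s2 by simp
    then have m2: "y - d \<ge> 2" by simp
    have "(s - 2)\<^sup>2 \<le> real (y - d)"
      using m d Du s8 by (simp add: power2_eq_square algebra_simps)
    then have "s - 2 \<le> sqrt (y - d)" by (rule real_le_rsqrt)
    then have "exp (s / 16 - 1 / 8) \<le> exp (sqrt (y - d) / 16)" by simp
    moreover have "exp (s / 16) * (7 / 8) \<le> exp (s / 16 - 1 / 8)"
    proof -
      have "exp (s / 16) * (7 / 8) \<le> exp (s / 16) * exp (- 1 / 8)"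
        using exp_ge_add_one_self[of "- 1 / 8"] by (intro mult_left_mono) auto
      also have "\<dots> = exp (s / 16 - 1 / 8)" by (simp add: exp_add[symmetric])
      finally show ?thesis .
    qed
    ultimately have "\<alpha> * (exp (s / 16) * (7 / 8)) \<le> \<alpha> * exp (sqrt (y - d) / 16)"
      using \<alpha> by (intro mult_left_mono) linarith+
    also have "\<dots> \<le> weight_coeff (y - d)" using IH[OF m2] y by simp
    finally show ?thesis by (simp only: mult.assoc)
  qed
  have "(s - 1) * (2 * s - 1) \<le> real D * (real D + 1) / 2"
  proof -
    have "(2 * s - 2) * (2 * s - 1) \<le> real D * (real D + 1)"
      using Dl s8 by (intro mult_mono) auto
    then show ?thesis by (simp add: algebra_simps)
  qed
  also have "\<dots> = (\<Sum>d\<le>D. real d)"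
    by (induction D) (auto simp: field_simps)
  finally have sumD: "(s - 1) * (2 * s - 1) \<le> (\<Sum>d\<le>D. real d)" .
  \<comment> \<open>Even after the loss of the factor \<open>7 / 8\<close> the leading term
    \<open>7 / 4 * s * s\<close> exceeds the divisor \<open>z = s * s\<close> of the recursion;
    \<open>s \<ge> 8\<close> absorbs the linear term.\<close>
  have "(s - 1) * (2 * s - 1) * (7 / 8) = s * s * (7 / 4) - s * (21 / 8) + 7 / 8"
    by (simp add: algebra_simps)
  then have "s * s \<le> (s - 1) * (2 * s - 1) * (7 / 8)"
    using \<open>8 * s \<le> s * s\<close> s8 by linarith
  then have "\<alpha> * exp (s / 16) * real z \<le> \<alpha> * exp (s / 16) * ((s - 1) * (2 * s - 1) * (7 / 8))"
    using \<alpha> ss by (intro mult_left_mono) auto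
  also have "\<dots> \<le> (\<alpha> * exp (s / 16) * (7 / 8)) * (\<Sum>d\<le>D. real d)"
  proof -
    have "(\<alpha> * exp (s / 16) * (7 / 8)) * ((s - 1) * (2 * s - 1)) \<le> (\<alpha> * exp (s / 16) * (7 / 8)) * (\<Sum>d\<le>D. real d)"
      using \<alpha> by (intro mult_left_mono sumD) simp
    then show ?thesis by (simp only: mult_ac)
  qed
  also have "\<dots> \<le> (\<Sum>d\<le>D. real d * weight_coeff (y - d))"
    unfolding sum_distrib_left mult.commute[of _ "real d" for d]
    by (intro sum_mono mult_left_mono low) auto
  also have "\<dots> \<le> (\<Sum>d\<le>y. real d * weight_coeff (y - d))"
    using Dz by (intro sum_mono2) (auto intro: mult_nonneg_nonneg weight_coeff_nonneg)
  also have "\<dots> = weight_coeff z * real z" using y by simp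
  finally show ?thesis using z by (simp add: s_def)
qed

lemma weight_coeff_growth:
  obtains \<alpha> :: real where "\<alpha> > 0" "\<And>z. z \<ge> 2 \<Longrightarrow> \<alpha> * exp (sqrt z / 16) \<le> weight_coeff z"
proof
  \<comment> \<open>\<open>\<alpha>\<close> is the smallest ratio over the initial range, so the
    bound holds there by construction; \<open>weight_coeff_step\<close> carries it beyond
    64.\<close>
  let ?Q = "(\<lambda>z. weight_coeff z / exp (sqrt (real z) / 16)) ` {2..64}"
  define \<alpha> where "\<alpha> = Min ?Q"
  have "\<alpha> \<in> ?Q" unfolding \<alpha>_def by (rule Min_in) auto
  then show pos: "\<alpha> > 0" by (auto intro!: divide_pos_pos weight_coeff_pos)
  show "\<alpha> * exp (sqrt z / 16) \<le> weight_coeff z" if "z \<ge> 2" for z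
    using that
  proof (induction z rule: less_induct)
    case (less z)
    show ?case
    proof (cases "z \<le> 64")
      case True
      then have "\<alpha> \<le> weight_coeff z / exp (sqrt z / 16)"
        unfolding \<alpha>_def using less by (intro Min_le) auto
      then show ?thesis by (simp add: field_simps)
    next
      case False
      show ?thesis
      proof (rule weight_coeff_step)
        show "z \<ge> 64" using False by simp
        show "\<alpha> * exp (sqrt m / 16) \<le> weight_coeff m" if "m \<ge> 2" "m < z" for m
          using that by (intro less.IH)
      qed (rule pos)
    qed
  qed
qed

section \<open>Products of ratios\<close>

lemma prod_ratio_ge:
  fixes n k z :: nat
  assumes "k \<ge> 1" "2 * k * z \<le> n" "n > 0"
  shows "exp (- (2 * real k * (real z)\<^sup>2 / real n)) \<le> (\<Prod>t<z. real (n - k * t) / real (n - t))"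
proof -
  let ?u = "real k * real z / real n"
  have factor: "exp (- 2 * ?u) \<le> real (n - k * t) / real (n - t)" if t: "t < z" for t
  proof -
    have kt: "k * t \<le> k * z" using t by simp
    have kt2: "2 * (k * t) \<le> n"
      by (rule order_trans[OF mult_le_mono2[OF kt] assms(2)[unfolded mult.assoc]])
    define x where "x = real (k * t) / real n"
    have x: "0 \<le> x" "x \<le> 1 / 2" "x \<le> ?u"
    proof -
      show "0 \<le> x" by (simp add: x_def)
      have "real (2 * (k * t)) \<le> real n" using kt2 by (rule of_nat_mono)
      then show "x \<le> 1 / 2" using assms by (simp add: x_def field_simps)
      have "real (k * t) \<le> real (k * z)" using kt by (rule of_nat_mono)
      then show "x \<le> ?u" unfolding x_def by (simp add: divide_right_mono)
    qed
    \<comment> \<open>For \<open>0 \<le> x \<le> 1 / 2\<close> the estimate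
      \<open>ln (1 - x) \<ge> - x - 2 * x\<^sup>2\<close> yields
      \<open>ln (1 - x) \<ge> - 2 * x\<close>.\<close>
    have "x * x \<le> x * (1 / 2)" using x by (intro mult_left_mono) auto
    then have "- 2 * ?u \<le> ln (1 - x)"
      using ln_one_minus_pos_lower_bound[of x] x by (simp add: power2_eq_square)
    then have "exp (- 2 * ?u) \<le> exp (ln (1 - x))" by (simp only: exp_le_cancel_iff)
    also have "\<dots> = 1 - x" using x by simp
    also have "\<dots> = real (n - k * t) / real n"
      using assms kt2 by (simp add: x_def field_simps of_nat_diff)
    also have "\<dots> \<le> real (n - k * t) / real (n - t)"
    proof (rule divide_left_mono)
      have "t < z" "z \<le> k * z" using t assms by auto
      then have "t < n" using assms(2) by linarith
      then show "0 < real n * real (n - t)" using assms by simp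
    qed auto
    finally show ?thesis .
  qed
  have "exp (- (2 * real k * (real z)\<^sup>2 / real n)) = (\<Prod>t<z. exp (- 2 * ?u))"
    by (simp add: exp_of_nat_mult[symmetric] power2_eq_square algebra_simps)
  also have "\<dots> \<le> (\<Prod>t<z. real (n - k * t) / real (n - t))"
    by (rule prod_mono) (use factor in auto)
  finally show ?thesis .
qed

lemma binomial_fact_prod:
  assumes "z \<le> n"
  shows "real (n choose z) * fact z = (\<Prod>t<z. real (n - t))"
proof -
  have "real (n choose z) * fact z = (\<Prod>t = 0..<z. real n - real t)"
    by (simp add: binomial_gbinomial gbinomial_prod_rev)
  also have "\<dots> = (\<Prod>t<z. real (n - t))"
    using assms by (intro prod.cong) (auto simp: atLeast0LessThan)
  finally show ?thesis .
qed

text \<open>\<open>n choose z\<close> times \<open>fact z\<close> is a falling factorial, which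
  cancels one of the two factors \<open>n - t\<close> in each denominator.\<close>

lemma binomial_ratio:
  assumes "z \<le> n"
  shows "real (n choose z) * fact z * (\<Prod>t<z. real (n - k * t) / (real (n - t))\<^sup>2)
    = (\<Prod>t<z. real (n - k * t) / real (n - t))"
  unfolding binomial_fact_prod[OF assms] prod.distrib[symmetric]
  by (intro prod.cong) (use assms in \<open>auto simp: power2_eq_square\<close>)

text \<open>For fixed \<open>A\<close>, the mappings that leave \<open>A\<close> invariant are
  grouped by the permutation \<open>\<pi>\<close> that they induce on \<open>A\<close>. Each group
  is \<open>extensions k n A \<pi>\<close>, whose size depends only on \<open>card A\<close>, and by
  the assumption \<open>w\<close> is constant on it.\<close>

lemma sum_invariant_extensions:
  fixes w :: "(nat \<Rightarrow> nat) \<Rightarrow> nat set \<Rightarrow> real"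
  assumes cong: "\<And>f g A. (\<And>x. x \<in> A \<Longrightarrow> f x = g x) \<Longrightarrow> w f A = w g A"
  shows "(\<Sum>f\<in>zero_k_mappings k n. \<Sum>A | A \<subseteq> {1..n} \<and> f ` A = A. w f A) =
    real (card (zero_k_mappings k n)) * (\<Sum>A\<in>Pow {1..n}.
      (\<Prod>t<card A. real (n - k * t) / (real (n - t))\<^sup>2) * (\<Sum>\<pi> | \<pi> permutes A. w \<pi> A))"
proof -
  let ?Z = "zero_k_mappings k n"
  let ?q = "\<lambda>A. \<Prod>t<card A. real (n - k * t) / (real (n - t))\<^sup>2"
  have inner: "(\<Sum>f | f \<in> ?Z \<and> f ` A = A. w f A) = real (card ?Z) * (?q A * (\<Sum>\<pi> | \<pi> permutes A. w \<pi> A))"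
    if A: "A \<in> Pow {1..n}" for A
  proof -
    have finA: "finite A" using A by (auto intro: finite_subset)
    let ?P = "{\<pi>. \<pi> permutes A}"
    have fib: "{f \<in> {f. f \<in> ?Z \<and> f ` A = A}. perm_restrict f A = \<pi>} = extensions k n A \<pi>"
      if p: "\<pi> permutes A" for \<pi>
    proof (intro set_eqI iffI)
      fix f assume "f \<in> {f \<in> {f. f \<in> ?Z \<and> f ` A = A}. perm_restrict f A = \<pi>}"
      then show "f \<in> extensions k n A \<pi>" by (auto simp: extensions_def perm_restrict_def)
    next
      fix f assume f: "f \<in> extensions k n A \<pi>"
      then have "f ` A = \<pi> ` A" by (auto simp: extensions_def)
      then have "f ` A = A" using permutes_image[OF p] by simp
      moreover have "perm_restrict f A = \<pi>"
        using f p by (auto simp: extensions_def perm_restrict_def permutes_def fun_eq_iff)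
      ultimately show "f \<in> {f \<in> {f. f \<in> ?Z \<and> f ` A = A}. perm_restrict f A = \<pi>}"
        using f by (simp add: extensions_def)
    qed
    have img: "(\<lambda>f. perm_restrict f A) ` {f. f \<in> ?Z \<and> f ` A = A} \<subseteq> ?P"
    proof (rule image_subsetI)
      fix f assume "f \<in> {f. f \<in> ?Z \<and> f ` A = A}"
      then have "bij_betw f A A" using finA by (simp add: bij_betw_def finite_surj_inj)
      then have "bij_betw (perm_restrict f A) A A"
        by (subst bij_betw_cong[where g = f]) (auto simp: perm_restrict_def)
      then show "perm_restrict f A \<in> ?P"
        by (simp add: bij_imp_permutes perm_restrict_def)
    qed
    have "(\<Sum>f | f \<in> ?Z \<and> f ` A = A. w f A)
        = (\<Sum>\<pi>\<in>?P. \<Sum>f\<in>{f \<in> {f. f \<in> ?Z \<and> f ` A = A}. perm_restrict f A = \<pi>}. w f A)"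
      by (rule sum.group[symmetric]) (use finite_zero_k_mappings finite_permutations[OF finA] img in auto)
    also have "\<dots> = (\<Sum>\<pi>\<in>?P. real (card ?Z) * ?q A * w \<pi> A)"
    proof (rule sum.cong[OF refl])
      fix \<pi> assume "\<pi> \<in> ?P"
      then have p: "\<pi> permutes A" by simp
      have "(\<Sum>f\<in>{f \<in> {f. f \<in> ?Z \<and> f ` A = A}. perm_restrict f A = \<pi>}. w f A)
          = (\<Sum>f\<in>extensions k n A \<pi>. w \<pi> A)"
        unfolding fib[OF p] by (intro sum.cong refl cong) (auto simp: extensions_def)
      also have "\<dots> = real (card (extensions k n A \<pi>)) * w \<pi> A" by simp
      also have "real (card (extensions k n A \<pi>)) = real (card ?Z) * ?q A"
        by (rule card_extensions) (use A p permutes_image[OF p] permutes_inj_on[OF p] in auto)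
      finally show "(\<Sum>f\<in>{f \<in> {f. f \<in> ?Z \<and> f ` A = A}. perm_restrict f A = \<pi>}. w f A)
          = real (card ?Z) * ?q A * w \<pi> A" .
    qed
    finally show ?thesis by (simp add: sum_distrib_left mult.assoc)
  qed
  have "(\<Sum>f\<in>?Z. \<Sum>A | A \<subseteq> {1..n} \<and> f ` A = A. w f A)
      = (\<Sum>f\<in>?Z. \<Sum>A | A \<in> Pow {1..n} \<and> f ` A = A. w f A)" by simp
  also have "\<dots> = (\<Sum>A\<in>Pow {1..n}. \<Sum>f | f \<in> ?Z \<and> f ` A = A. w f A)"
    by (rule sum.swap_restrict) (auto simp: finite_zero_k_mappings)
  also have "\<dots> = real (card ?Z) * (\<Sum>A\<in>Pow {1..n}. ?q A * (\<Sum>\<pi> | \<pi> permutes A. w \<pi> A))"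
    unfolding sum_distrib_left[of "real (card ?Z)"] by (intro sum.cong refl inner)
  finally show ?thesis .
qed

section \<open>Averages of \<open>2 ^ N\<close> and of the product of the cycle lengths\<close>

lemma mapping_cycles_eq: "mapping_cycles n f = cycles_in f {1..n}"
  by (simp add: mapping_cycles_def cycles_in_def)

text \<open>With all weights 1, the invariant sets of size \<open>z\<close> contribute on average a
  product of ratios, which is at most 1, and there are \<open>n + 1\<close> sizes.\<close>

lemma sum_two_power_cycles_le:
  assumes "k \<ge> 1"
  shows "(\<Sum>f\<in>zero_k_mappings k n. 2 ^ card (mapping_cycles n f))
    \<le> real (card (zero_k_mappings k n)) * (real n + 1)"
proof -
  let ?Z = "zero_k_mappings k n"
  let ?q = "\<lambda>z. \<Prod>t<z. real (n - k * t) / (real (n - t))\<^sup>2"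
  have "(\<Sum>f\<in>?Z. 2 ^ card (mapping_cycles n f)) = (\<Sum>f\<in>?Z. \<Sum>A | A \<subseteq> {1..n} \<and> f ` A = A. 1 :: real)"
    using sum_invariant_subsets[of "{1..n}" "\<lambda>_. 1 :: real"] by (simp add: mapping_cycles_eq)
  also have "\<dots> = real (card ?Z) * (\<Sum>A\<in>Pow {1..n}. ?q (card A) * (\<Sum>\<pi> | \<pi> permutes A. 1))"
    by (rule sum_invariant_extensions) simp
  also have "(\<Sum>A\<in>Pow {1..n}. ?q (card A) * (\<Sum>\<pi> | \<pi> permutes A. 1))
      = (\<Sum>A\<in>Pow {1..n}. ?q (card A) * fact (card A))"
    by (intro sum.cong refl) (simp add: card_permutations finite_subset[of _ "{1..n}"])
  also have "\<dots> = (\<Sum>z\<le>n. real (n choose z) * (?q z * fact z))"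
    using sum_Pow_card[of "{1..n}" "\<lambda>z. ?q z * fact z"] by simp
  also have "\<dots> = (\<Sum>z\<le>n. \<Prod>t<z. real (n - k * t) / real (n - t))"
  proof (rule sum.cong[OF refl])
    fix z assume "z \<in> {..n}"
    then show "real (n choose z) * (?q z * fact z) = (\<Prod>t<z. real (n - k * t) / real (n - t))"
      using binomial_ratio[of z n k] by (simp add: mult_ac)
  qed
  also have "\<dots> \<le> (\<Sum>z\<le>n. 1)"
  proof (intro sum_mono prod_le_1 conjI)
    fix z t assume "z \<in> {..n}" "t \<in> {..<z}"
    then have "t < n" by simp
    moreover have "n - k * t \<le> n - t" using assms by (intro diff_le_mono2) simp
    ultimately show "real (n - k * t) / real (n - t) \<le> 1" by (simp add: divide_le_eq_1)
  qed auto
  finally show ?thesis by (simp add: mult_left_mono add.commute)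
qed

text \<open>With the weights \<open>card C - 1\<close> every set contributes a nonnegative amount,
  so all sizes other than \<open>z\<close> may be dropped.\<close>

lemma sum_cycle_product_ge:
  assumes "z \<le> n"
  shows "real (card (zero_k_mappings k n)) * (weight_coeff z * (\<Prod>t<z. real (n - k * t) / real (n - t)))
    \<le> (\<Sum>f\<in>zero_k_mappings k n. real (cycle_product n f))"
proof -
  let ?Z = "zero_k_mappings k n"
  let ?q = "\<lambda>z. \<Prod>t<z. real (n - k * t) / (real (n - t))\<^sup>2"
  let ?S = "{A \<in> Pow {1..n}. card A = z}"
  have q0: "0 \<le> ?q z" for z by (intro prod_nonneg) auto
  have wc: "0 \<le> cycle_weight_sum A" if "A \<subseteq> {1..n}" for A :: "nat set"
    unfolding cycle_weight_sum_def using that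
    by (intro sum_nonneg prod_cycle_weight_nonneg) (auto intro: finite_subset)
  have "weight_coeff z * (\<Prod>t<z. real (n - k * t) / real (n - t))
      = real (n choose z) * (?q z * (fact z * weight_coeff z))"
    unfolding binomial_ratio[OF assms, symmetric] by simp
  also have "\<dots> = (\<Sum>A\<in>?S. ?q (card A) * (fact (card A) * weight_coeff (card A)))"
    using n_subsets[of "{1..n}" z] by simp
  also have "\<dots> \<le> (\<Sum>A\<in>?S. ?q (card A) * cycle_weight_sum A)"
    by (intro sum_mono mult_left_mono cycle_weight_sum_ge q0) (auto intro: finite_subset)
  also have "\<dots> \<le> (\<Sum>A\<in>Pow {1..n}. ?q (card A) * cycle_weight_sum A)"
    by (intro sum_mono2 mult_nonneg_nonneg q0 wc) auto
  finally have "real (card ?Z) * (weight_coeff z * (\<Prod>t<z. real (n - k * t) / real (n - t)))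
      \<le> real (card ?Z) * (\<Sum>A\<in>Pow {1..n}. ?q (card A) * cycle_weight_sum A)"
    by (rule mult_left_mono) simp
  also have "\<dots> = (\<Sum>f\<in>?Z. \<Sum>A | A \<subseteq> {1..n} \<and> f ` A = A. \<Prod>C\<in>cycles_in f A. real (card C) - 1)"
    unfolding cycle_weight_sum_def
    by (rule sum_invariant_extensions[symmetric]) (metis cycles_in_cong)
  also have "\<dots> = (\<Sum>f\<in>?Z. real (cycle_product n f))"
    by (intro sum.cong refl)
      (simp add: sum_invariant_subsets cycle_product_def mapping_cycles_eq of_nat_prod)
  finally show ?thesis .
qed

lemma expected_cycle_product_ge:
  assumes "k \<ge> 1" "k dvd n" "z \<le> n"
  shows "weight_coeff z * (\<Prod>t<z. real (n - k * t) / real (n - t)) \<le> expected_cycle_product k n"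
proof -
  have ne: "zero_k_mappings k n \<noteq> {}" using assms by (intro zero_k_mappings_nonempty) auto
  then have "card (zero_k_mappings k n) > 0" by (simp add: card_gt_0_iff finite_zero_k_mappings)
  then show ?thesis
    using sum_cycle_product_ge[OF assms(3), of k]
    by (simp add: expected_cycle_product_def uniform_zero_k_mapping_def
        integral_pmf_of_set[OF ne finite_zero_k_mappings] field_simps)
qed

lemma expected_cycle_product_growth:
  fixes k :: nat
  assumes k: "k \<ge> 1"
  obtains c where "c > 0"
    "\<forall>\<^sub>F n in sequentially. k dvd n \<longrightarrow> exp (c * real n powr (1/3)) \<le> expected_cycle_product k n"
proof -
  obtain \<alpha> :: real where \<alpha>: "\<alpha> > 0" "\<And>z. z \<ge> 2 \<Longrightarrow> \<alpha> * exp (sqrt z / 16) \<le> weight_coeff z"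
    using weight_coeff_growth by blast
  \<comment> \<open>For \<open>X = n powr (1/3)\<close> and \<open>z\<close> close to
    \<open>s\<^sup>2 * X\<^sup>2\<close>, the coefficient gains at least \<open>s / 32 * X\<close>
    in the exponent, and the product loses at most \<open>2 * k * s\<^sup>2 * X\<close>, which this
    \<open>s\<close> turns into \<open>s / 64 * X\<close>. The net rate \<open>s / 64\<close> is
    \<open>2 * c\<close>.\<close>
  define s where "s = 1 / (128 * real k)"
  have s: "0 < s" "s \<le> 1" using k by (auto simp: s_def field_simps)
  define c where "c = s / 128"
  have c: "c > 0" using s by (simp add: c_def)
  have ev1: "\<forall>\<^sub>F n in sequentially. 4 \<le> s\<^sup>2 * real n powr (2/3)"
    using s by real_asymp
  have ev2: "\<forall>\<^sub>F n in sequentially. 2 * real k * (s\<^sup>2 * real n powr (2/3)) \<le> real n"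
    using s k by real_asymp
  \<comment> \<open>Half of the rate \<open>2 * c\<close> is given up to absorb the constant
    \<open>\<alpha>\<close>.\<close>
  have ev3: "\<forall>\<^sub>F n in sequentially. exp (c * real n powr (1/3)) \<le> \<alpha> * exp (2 * c * real n powr (1/3))"
    using c \<alpha> by real_asymp
  have "\<forall>\<^sub>F n in sequentially. k dvd n \<longrightarrow> exp (c * real n powr (1/3)) \<le> expected_cycle_product k n"
    using ev1 ev2 ev3 eventually_gt_at_top[of 0]
  proof eventually_elim
    case (elim n)
    define X where "X = real n powr (1/3)"
    have X: "X > 0" using elim by (simp add: X_def)
    have X2: "real n powr (2/3) = X\<^sup>2" using elim by (simp add: X_def powr_power)
    have X3: "real n = X ^ 3" using elim by (simp add: X_def powr_power)
    define z where "z = nat \<lfloor>s\<^sup>2 * X\<^sup>2\<rfloor>"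
    have z_le: "real z \<le> s\<^sup>2 * X\<^sup>2" and z_gt: "s\<^sup>2 * X\<^sup>2 - 1 < real z"
      by (auto simp: z_def of_nat_nat)
    have four: "4 \<le> s\<^sup>2 * X\<^sup>2" using elim(1) X2 by simp
    have z2: "z \<ge> 2" using z_gt four by linarith
    have "2 * real k * real z \<le> real n"
      using elim(2) mult_left_mono[OF z_le, of "2 * real k"] X2 by simp
    then have kz: "2 * k * z \<le> n" by (metis of_nat_le_iff of_nat_mult of_nat_numeral)
    have "z \<le> 2 * k * z" using k by simp
    then have zn: "z \<le> n" using kz by linarith
    \<comment> \<open>Rounding down costs at most 1, and
      \<open>s\<^sup>2 * X\<^sup>2 \<ge> 4\<close>, so more than a quarter of it remains.\<close>
    have "(s * X / 2)\<^sup>2 \<le> real z" using z_gt four by (simp add: power_mult_distrib field_simps)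
    then have sq: "s * X / 2 \<le> sqrt z" by (rule real_le_rsqrt)
    have "(real z)\<^sup>2 \<le> (s\<^sup>2 * X\<^sup>2)\<^sup>2" using z_le by (intro power_mono) auto
    then have "2 * real k * (real z)\<^sup>2 / real n \<le> 2 * real k * (s\<^sup>2 * X\<^sup>2)\<^sup>2 / real n"
      by (intro divide_right_mono mult_left_mono) auto
    also have "\<dots> = 2 * real k * s ^ 4 * X"
      using X by (simp add: X3 field_simps power_mult_distrib power_numeral_reduce)
    also have "\<dots> \<le> 2 * real k * s\<^sup>2 * X"
    proof -
      have "s ^ 4 \<le> s\<^sup>2" using s by (intro power_decreasing) auto
      then show ?thesis using X by (intro mult_right_mono mult_left_mono) auto
    qed
    also have "\<dots> = s / 64 * X" using k by (simp add: s_def power2_eq_square)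
    finally have pr: "2 * real k * (real z)\<^sup>2 / real n \<le> s / 64 * X" .
    have "2 * c * X \<le> sqrt z / 16 - 2 * real k * (real z)\<^sup>2 / real n"
      using sq pr by (simp add: c_def)
    then have "exp (2 * c * X) \<le> exp (sqrt z / 16) * exp (- (2 * real k * (real z)\<^sup>2 / real n))"
      by (simp add: exp_add[symmetric])
    then have "\<alpha> * exp (2 * c * X) \<le> (\<alpha> * exp (sqrt z / 16)) * exp (- (2 * real k * (real z)\<^sup>2 / real n))"
      using \<alpha>(1) by simp
    also have "\<dots> \<le> weight_coeff z * (\<Prod>t<z. real (n - k * t) / real (n - t))"
      by (intro mult_mono \<alpha>(2)[OF z2] prod_ratio_ge[OF k kz elim(4)] weight_coeff_nonneg) auto
    finally have "exp (c * X) \<le> weight_coeff z * (\<Prod>t<z. real (n - k * t) / real (n - t))"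
      using elim(3) by (simp add: X_def)
    then show ?case using expected_cycle_product_ge[OF k _ zn] by (auto simp: X_def intro: order_trans)
  qed
  then show ?thesis using that c by blast
qed

subsection \<open>Waiting times\<close>

text \<open>A nonempty set of successful trials attains its infimum, and an empty one gives
  infinity, which exceeds every real \<open>r\<close>. Hence finitely many trials decide the
  event.\<close>

lemma waiting_time_le_iff:
  assumes "r \<ge> 0"
  shows "ennreal_of_enat (waiting_time n x F \<omega>) \<le> ennreal r \<longleftrightarrow>
    (\<exists>t\<in>{1..nat \<lfloor>r\<rfloor>}. real (cycle_product n (F t \<omega>)) \<ge> x)"
proof
  let ?T = "{t. t \<ge> 1 \<and> real (cycle_product n (F t \<omega>)) \<ge> x}"
  assume l: "ennreal_of_enat (waiting_time n x F \<omega>) \<le> ennreal r"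
  have "?T \<noteq> {}"
  proof
    assume e: "?T = {}"
    have "waiting_time n x F \<omega> = \<infinity>"
      unfolding waiting_time_def e by (simp add: Inf_enat_def)
    then show False using l by (simp add: top_unique)
  qed
  then obtain t' where "t' \<in> ?T" by blast
  then have "waiting_time n x F \<omega> \<in> enat ` ?T"
    unfolding waiting_time_def by (intro wellorder_InfI[of "enat t'"]) (rule imageI)
  then obtain t where t: "t \<in> ?T" "waiting_time n x F \<omega> = enat t" by blast
  then have "real t \<le> r"
    using l assms by (simp add: ennreal_of_nat_eq_real_of_nat)
  then have "t \<le> nat \<lfloor>r\<rfloor>" by (simp add: le_nat_floor)
  then show "\<exists>t\<in>{1..nat \<lfloor>r\<rfloor>}. real (cycle_product n (F t \<omega>)) \<ge> x" using t by auto
next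
  assume "\<exists>t\<in>{1..nat \<lfloor>r\<rfloor>}. real (cycle_product n (F t \<omega>)) \<ge> x"
  then obtain t where t: "t \<in> {1..nat \<lfloor>r\<rfloor>}" "real (cycle_product n (F t \<omega>)) \<ge> x" by blast
  then have "waiting_time n x F \<omega> \<le> enat t"
    unfolding waiting_time_def by (intro Inf_lower) auto
  then have "ennreal_of_enat (waiting_time n x F \<omega>) \<le> of_nat t"
    using ennreal_of_enat_le_iff[of _ "enat t"] by simp
  also have "\<dots> \<le> ennreal r"
  proof -
    have "real t \<le> real (nat \<lfloor>r\<rfloor>)" using t by simp
    also have "\<dots> \<le> r" using assms by (simp add: of_nat_floor)
    finally show ?thesis by (simp add: ennreal_of_nat_eq_real_of_nat ennreal_leI)
  qed
  finally show "ennreal_of_enat (waiting_time n x F \<omega>) \<le> ennreal r" .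
qed

text \<open>The event \<open>E\<close> is a union of at most \<open>r\<close> events of probability
  at most \<open>p\<close>. Outside \<open>E\<close> the waiting time exceeds \<open>r\<close>,
  which bounds its expectation from below by \<open>r\<close> times the probability of the
  complement.\<close>

lemma waiting_time_bounds:
  assumes iid: "iid_uniform_mappings k n M F" and r: "r \<ge> 0"
    and p: "measure_pmf.prob (uniform_zero_k_mapping k n) {f. x \<le> real (cycle_product n f)} \<le> p"
  defines "E \<equiv> {\<omega> \<in> space M. ennreal_of_enat (waiting_time n x F \<omega>) \<le> ennreal r}"
  shows "measure M E \<le> r * p"
    and "ennreal (r * (1 - r * p)) \<le> (\<integral>\<^sup>+ \<omega>. ennreal_of_enat (waiting_time n x F \<omega>) \<partial>M)"
proof -
  interpret prob_space M using iid by (simp add: iid_uniform_mappings_def)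
  have meas: "F t \<in> measurable M (count_space UNIV)" if "t \<ge> 1" for t
    using iid that unfolding iid_uniform_mappings_def indep_vars_def by auto
  let ?A = "\<lambda>t. {\<omega> \<in> space M. x \<le> real (cycle_product n (F t \<omega>))}"
  have A: "?A t = F t -` {f. x \<le> real (cycle_product n f)} \<inter> space M" for t by auto
  have Aev: "?A t \<in> events" if "t \<ge> 1" for t
    unfolding A using meas[OF that] by (rule measurable_sets) simp
  have Ap: "prob (?A t) \<le> p" if "t \<ge> 1" for t
  proof -
    have "prob (?A t) = measure (distr M (count_space UNIV) (F t)) {f. x \<le> real (cycle_product n f)}"
      unfolding A using meas[OF that] by (subst measure_distr) auto
    also have "distr M (count_space UNIV) (F t) = measure_pmf (uniform_zero_k_mapping k n)"
      using iid that by (simp add: iid_uniform_mappings_def)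
    finally show ?thesis using p by simp
  qed
  have E: "E = (\<Union>t\<in>{1..nat \<lfloor>r\<rfloor>}. ?A t)"
    unfolding E_def waiting_time_le_iff[OF r] by blast
  have Eev: "E \<in> events" unfolding E by (intro sets.finite_UN Aev) auto
  have p0: "0 \<le> p" using p by (rule order_trans[OF measure_nonneg])
  have "prob E \<le> (\<Sum>t\<in>{1..nat \<lfloor>r\<rfloor>}. prob (?A t))"
    unfolding E by (rule finite_measure_subadditive_finite) (use Aev in auto)
  also have "\<dots> \<le> (\<Sum>t\<in>{1..nat \<lfloor>r\<rfloor>}. p)" by (intro sum_mono Ap) auto
  also have "\<dots> \<le> r * p" using p0 r by (simp add: mult_right_mono of_nat_floor)
  finally show Ele: "prob E \<le> r * p" .
  have "ennreal (r * (1 - r * p)) \<le> ennreal (r * prob (space M - E))"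
    using Ele r by (intro ennreal_leI mult_left_mono) (simp_all add: prob_compl[OF Eev])
  also have "\<dots> = (\<integral>\<^sup>+ \<omega>. ennreal r * indicator (space M - E) \<omega> \<partial>M)"
    using Eev r by (simp add: nn_integral_cmult_indicator emeasure_eq_measure ennreal_mult)
  also have "\<dots> \<le> (\<integral>\<^sup>+ \<omega>. ennreal_of_enat (waiting_time n x F \<omega>) \<partial>M)"
    by (intro nn_integral_mono) (auto simp: indicator_def E_def)
  finally show "ennreal (r * (1 - r * p)) \<le> (\<integral>\<^sup>+ \<omega>. ennreal_of_enat (waiting_time n x F \<omega>) \<partial>M)" .
qed

section \<open>The tail of the product of the cycle lengths\<close>

lemma cycle_product_le_power: "cycle_product n f \<le> n ^ card (mapping_cycles n f)"
proof -
  have "cycle_product n f \<le> (\<Prod>C\<in>mapping_cycles n f. n)"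
    unfolding cycle_product_def
  proof (rule prod_mono)
    fix C assume "C \<in> mapping_cycles n f"
    then have "C \<subseteq> {1..n}" by (simp add: mapping_cycles_def)
    then have "card C \<le> card {1..n}" by (intro card_mono) auto
    then show "0 \<le> card C \<and> card C \<le> n" by simp
  qed
  then show ?thesis by simp
qed

lemma prob_cycle_product_ge:
  assumes k: "k \<ge> 1" "k dvd n" and n: "n \<ge> 2" and x: "exp (m * ln (real n)) \<le> x"
  shows "measure_pmf.prob (uniform_zero_k_mapping k n) {f. x \<le> real (cycle_product n f)}
    \<le> (real n + 1) * 2 powr (- m)"
proof -
  let ?Z = "zero_k_mappings k n"
  let ?S = "?Z \<inter> {f. x \<le> real (cycle_product n f)}"
  have ne: "?Z \<noteq> {}" using k by (intro zero_k_mappings_nonempty) auto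
  then have pos: "real (card ?Z) > 0" by (simp add: card_gt_0_iff finite_zero_k_mappings)
  have many: "2 powr m \<le> 2 ^ card (mapping_cycles n f)" if "x \<le> real (cycle_product n f)" for f
  proof -
    let ?c = "card (mapping_cycles n f)"
    have "exp (m * ln (real n)) \<le> real (n ^ ?c)"
      using x that cycle_product_le_power[of n f] by (meson of_nat_mono order_trans)
    also have "\<dots> = exp (real ?c * ln (real n))" using n by (simp add: exp_of_nat_mult)
    finally have "m \<le> real ?c" using n by simp
    then have "2 powr m \<le> 2 powr real ?c" by (intro powr_mono) auto
    then show ?thesis by (simp add: powr_realpow)
  qed
  \<comment> \<open>Markov's inequality in counting form; \<open>m\<close> is the number of cycles
    that the threshold \<open>x\<close> forces.\<close>
  have "real (card ?S) * 2 powr m = (\<Sum>f\<in>?S. 2 powr m)" by simp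
  also have "\<dots> \<le> (\<Sum>f\<in>?S. 2 ^ card (mapping_cycles n f))" by (intro sum_mono many) auto
  also have "\<dots> \<le> (\<Sum>f\<in>?Z. 2 ^ card (mapping_cycles n f))"
    by (intro sum_mono2 finite_zero_k_mappings) auto
  also have "\<dots> \<le> real (card ?Z) * (real n + 1)" by (rule sum_two_power_cycles_le[OF k(1)])
  finally have "real (card ?S) / real (card ?Z) \<le> (real n + 1) * 2 powr (- m)"
    using pos by (simp add: powr_minus field_simps)
  then show ?thesis
    by (simp add: uniform_zero_k_mapping_def measure_pmf_of_set[OF ne finite_zero_k_mappings])
qed

lemma eventually_multiples_at_topI:
  assumes "eventually P sequentially"
  shows "\<forall>\<^sub>F n in multiples_at_top k. k dvd n \<and> P n"
  using eventually_mono[OF assms, of "\<lambda>n. k dvd n \<longrightarrow> k dvd n \<and> P n"]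
  by (simp add: multiples_at_top_def eventually_inf_principal)

text \<open>Let \<open>c\<close> be the growth constant of the expectation. The assumption on
  \<open>b\<close> makes \<open>c * b n\<close> eventually at least \<open>48 / ln n ^ 2\<close>, so
  raising \<open>exp (c * n powr (1/3))\<close> to the power \<open>b n\<close> gives the stated
  exponent, arranged as a number of cycles times \<open>ln n\<close>.\<close>

lemma eventually_threshold:
  fixes k :: nat and b :: "nat \<Rightarrow> real"
  assumes k: "k \<ge> 1"
    and b: "(\<lambda>n. inverse (b n) * inverse (ln (real n) ^ 2)) \<in> o[multiples_at_top k](\<lambda>_. 1)"
    and bpos: "\<And>n. n > 0 \<Longrightarrow> k dvd n \<Longrightarrow> b n > 0"
  shows "\<forall>\<^sub>F n in multiples_at_top k.
    exp (48 * real n powr (1/3) / ln (real n) ^ 3 * ln (real n)) \<le> expected_cycle_product k n powr b n"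
proof -
  obtain c where c: "c > 0"
    "\<forall>\<^sub>F n in sequentially. k dvd n \<longrightarrow> exp (c * real n powr (1/3)) \<le> expected_cycle_product k n"
    using expected_cycle_product_growth[OF k] by blast
  have ev1: "\<forall>\<^sub>F n in multiples_at_top k. norm (inverse (b n) * inverse (ln (real n) ^ 2)) \<le> (c / 48) * norm (1::real)"
    using landau_o.smallD[OF b, of "c / 48"] c(1) by simp
  have ev2: "\<forall>\<^sub>F n in multiples_at_top k. exp (c * real n powr (1/3)) \<le> expected_cycle_product k n"
    using c(2) by (simp add: multiples_at_top_def eventually_inf_principal)
  note ev3 = eventually_multiples_at_topI[OF eventually_ge_at_top[of "2::nat"], of k]
  show ?thesis using ev1 ev2 ev3
  proof eventually_elim
    case (elim n)
    have bn: "b n > 0" using bpos elim by simp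
    have L: "ln (real n) > 0" using elim by simp
    let ?X = "real n powr (1/3)"
    have "1 / (b n * ln (real n) ^ 2) \<le> c / 48"
      using elim(1) bn L by (simp add: field_simps)
    then have "48 / ln (real n) ^ 2 \<le> c * b n"
      using bn L by (simp add: field_simps)
    then have "48 / ln (real n) ^ 2 * ?X \<le> c * b n * ?X" by (rule mult_right_mono) simp
    moreover have "48 * ?X / ln (real n) ^ 3 * ln (real n) = 48 / ln (real n) ^ 2 * ?X"
      using L by (simp add: power2_eq_square power3_eq_cube)
    ultimately have "exp (48 * ?X / ln (real n) ^ 3 * ln (real n)) \<le> exp (c * ?X) powr b n"
      by (simp add: exp_powr_real mult_ac)
    also have "\<dots> \<le> expected_cycle_product k n powr b n"
      using elim(2) bn by (intro powr_mono2) auto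
    finally show ?case .
  qed
qed

theorem theorem6p5:
  fixes k :: nat and lam :: real and b \<xi> :: "nat \<Rightarrow> real" and rate :: "nat \<Rightarrow> real"
  assumes "k \<ge> 2"
    and "lam = real k - 1"
    and "\<And>n. n > 0 \<Longrightarrow> k dvd n \<Longrightarrow> b n > 0"
    and "(\<lambda>n. inverse (b n) * inverse (ln (real n) ^ 2)) \<in> o[multiples_at_top k](\<lambda>_. 1)"
    and "\<And>n. \<xi> n = expected_cycle_product k n powr b n"
    and "\<And>n. rate n = (real n / lam) powr (1/3) / ln (real n / lam) ^ 3"
  shows "\<exists>c1>0. \<exists>c2>0. \<forall>\<^sub>F n in multiples_at_top k.
    \<forall>(M :: 'a measure) F. iid_uniform_mappings k n M F \<longrightarrow>
      (\<integral>\<^sup>+ \<omega>. ennreal_of_enat (waiting_time n (\<xi> n) F \<omega>) \<partial>M) > ennreal (exp (c1 * rate n)) \<and>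
      measure M {\<omega> \<in> space M.
          ennreal_of_enat (waiting_time n (\<xi> n) F \<omega>) \<le> ennreal (exp (c2 * rate n))}
        \<le> exp (- c2 * rate n)"
proof -
  \<comment> \<open>With \<open>Y = n powr (1/3) / ln n ^ 3\<close>, an amount \<open>8 * Y\<close>
    pays for \<open>ln (n + 1)\<close> and \<open>16 * Y\<close> for \<open>2 * rate n\<close>; the
    bound \<open>ln 2 \<ge> 1 / 2\<close> doubles the total to 48.\<close>
  define m where "m n = 48 * real n powr (1/3) / ln (real n) ^ 3" for n :: nat
  have k: "k \<ge> 1" using assms(1) by simp
  have lam: "lam \<ge> 1" using assms(1,2) by simp
  have thr: "\<forall>\<^sub>F n in multiples_at_top k. exp (m n * ln (real n)) \<le> \<xi> n"
    using eventually_threshold[OF k assms(4,3)] by (simp only: m_def assms(5))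
  have "\<forall>\<^sub>F n in sequentially. 2 \<le> (real n / lam) powr (1/3) / ln (real n / lam) ^ 3"
    using lam by real_asymp
  then have r2: "\<forall>\<^sub>F n in sequentially. 2 \<le> rate n" by (simp only: assms(6))
  \<comment> \<open>Dividing \<open>n\<close> by \<open>lam\<close> at most halves the logarithm, so
    its cube in \<open>rate\<close> costs at most the factor 8.\<close>
  have ev_ln: "\<forall>\<^sub>F n in sequentially. ln (real n) / 2 \<le> ln (real n / lam)"
    using lam by real_asymp
  have ev_n: "\<forall>\<^sub>F n in sequentially. ln (real n + 1) \<le> 8 * real n powr (1/3) / ln (real n) ^ 3"
    by real_asymp
  have "\<forall>\<^sub>F n in sequentially. 2 \<le> n \<and> 2 \<le> rate n \<and> (real n + 1) * 2 powr (- m n) \<le> exp (- 2 * rate n)"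
    using r2 ev_ln ev_n eventually_ge_at_top[of 2]
  proof eventually_elim
    case (elim n)
    define L where "L = ln (real n)"
    define Y where "Y = real n powr (1/3) / L ^ 3"
    have L: "L > 0" using elim by (simp add: L_def)
    have Y: "Y \<ge> 0" using L by (simp add: Y_def)
    have "rate n \<le> real n powr (1/3) / (L / 2) ^ 3"
      unfolding assms(6)
    proof (rule frac_le)
      have "real n / lam \<le> real n" using lam mult_left_mono[of 1 lam "real n"] by (simp add: divide_le_eq)
      then show "(real n / lam) powr (1/3) \<le> real n powr (1/3)" using lam by (intro powr_mono2) auto
      show "(L / 2) ^ 3 \<le> ln (real n / lam) ^ 3" using elim(2) L by (intro power_mono) (auto simp: L_def)
    qed (use L in auto)
    then have rY: "rate n \<le> 8 * Y" by (simp add: Y_def power_divide mult.commute)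
    have "ln (real n + 1) \<le> 8 * Y" using elim(3) by (simp add: Y_def L_def)
    moreover have "48 * Y * (1 / 2) \<le> 48 * Y * ln 2"
      using Y ln2_ge_two_thirds by (intro mult_left_mono) linarith+
    then have "48 * Y * (1 / 2) \<le> m n * ln 2"
      by (simp add: m_def Y_def L_def)
    ultimately have "ln (real n + 1) - m n * ln 2 \<le> - 2 * rate n" using rY by linarith
    then have "exp (ln (real n + 1) - m n * ln 2) \<le> exp (- 2 * rate n)" by (simp only: exp_le_cancel_iff)
    moreover have "exp (ln (real n + 1) - m n * ln 2) = (real n + 1) * 2 powr (- m n)"
      by (simp add: powr_def exp_diff exp_minus divide_inverse)
    ultimately show ?case using elim by simp
  qed
  note ev = eventually_multiples_at_topI[OF this, of k]
  \<comment> \<open>The constants are \<open>c1 = 1 / 2\<close> and \<open>c2 = 1\<close>: at most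
    \<open>exp (rate n)\<close> trials, each reaching the threshold with probability at most
    \<open>exp (- 2 * rate n)\<close>, give the union bound \<open>exp (- rate n)\<close>.\<close>
  have "\<forall>\<^sub>F n in multiples_at_top k.
    \<forall>(M :: 'a measure) F. iid_uniform_mappings k n M F \<longrightarrow>
      (\<integral>\<^sup>+ \<omega>. ennreal_of_enat (waiting_time n (\<xi> n) F \<omega>) \<partial>M) > ennreal (exp (1 / 2 * rate n)) \<and>
      measure M {\<omega> \<in> space M.
          ennreal_of_enat (waiting_time n (\<xi> n) F \<omega>) \<le> ennreal (exp (1 * rate n))}
        \<le> exp (- 1 * rate n)"
    using thr ev
  proof eventually_elim
    case (elim n)
    have p: "measure_pmf.prob (uniform_zero_k_mapping k n) {f. \<xi> n \<le> real (cycle_product n f)} \<le> exp (- 2 * rate n)"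
      using prob_cycle_product_ge[OF k _ _ elim(1)] elim(2) by (auto intro: order_trans)
    \<comment> \<open>The lower bound for the expectation is
      \<open>exp (rate n) - 1 = u * u - 1\<close>. Since \<open>rate n \<ge> 2\<close> gives
      \<open>u \<ge> 2\<close>, it exceeds \<open>u\<close>, which is why \<open>c1\<close> is
      smaller than \<open>c2\<close>.\<close>
    define u where "u = exp (1 / 2 * rate n)"
    have "u \<ge> 2"
      unfolding u_def using exp_ge_add_one_self[of "1 / 2 * rate n"] elim(2) by linarith
    then have "2 * u \<le> u * u" by (intro mult_right_mono) auto
    then have uu: "u < u * u - 1" using \<open>u \<ge> 2\<close> by linarith
    have e2: "exp (1 * rate n) * exp (- 2 * rate n) = exp (- 1 * rate n)" by (simp add: exp_add[symmetric])
    have e3: "exp (1 * rate n) * (1 - exp (- 1 * rate n)) = u * u - 1"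
      by (simp add: right_diff_distrib exp_add[symmetric] u_def)
    show ?case
    proof (intro allI impI conjI)
      fix M :: "'a measure" and F
      assume iid: "iid_uniform_mappings k n M F"
      note w = waiting_time_bounds[OF iid exp_ge_zero[of "1 * rate n"] p, unfolded e2]
      show "measure M {\<omega> \<in> space M.
          ennreal_of_enat (waiting_time n (\<xi> n) F \<omega>) \<le> ennreal (exp (1 * rate n))} \<le> exp (- 1 * rate n)"
        by (rule w(1))
      have "ennreal u < ennreal (u * u - 1)" using uu \<open>u \<ge> 2\<close> by (intro ennreal_lessI) auto
      also have "\<dots> \<le> (\<integral>\<^sup>+ \<omega>. ennreal_of_enat (waiting_time n (\<xi> n) F \<omega>) \<partial>M)"
        using w(2) unfolding e3 .
      finally show "ennreal (exp (1 / 2 * rate n)) < (\<integral>\<^sup>+ \<omega>. ennreal_of_enat (waiting_time n (\<xi> n) F \<omega>) \<partial>M)"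
        unfolding u_def .
    qed
  qed
  then show ?thesis by (intro exI[of _ "1 / 2 :: real"] exI[of _ "1 :: real"] conjI) auto
qed

end
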